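(* Let $M$ be a weakly compressible monoid (given by a finite presentation that is weakly compressible), and let $L(M)$ be its left monoid. If $L(M)$ has context-free word problem, then the rational subset membership problem for $M$ is decidable.
   Context: Words. $A^\ast$ is the free monoid on a finite alphabet $A$, with identity the empty word $\varepsilon$; $A^+ = A^\ast\setminus\{\varepsilon\}$; $u\equiv v$ means equality of words; $w^{\mathrm{rev}}$ is the reverse of $w$. A word is self-overlap free if it is empty, or if no proper non-empty prefix of it is also a proper non-empty suffix of it. Word problem. Let $N$ be a monoid generated by a finite set $B$, i.e. with a surjective homomorphism $\pi\colon B^\ast\to N$; write $u=_N v$ for $\pi(u)=\pi(v)$. The word problem of $N$ with respect to $B$ is the language $\mathrm{WP}^N_B=\{u\# v^{\mathrm{rev}} : u,v\in B^\ast,\ u=_N v\}$, where $\#\notin B$ is a fixed symbol. $N$ has context-free word problem if this language is context-free (this is independent of the choice of finite generating set $B$). Rational subset membership problem. For a monoid $M$ generated by a finite set $A$ with surjective homomorphism $\pi\colon A^\ast\to M$, this is the decision problem: given a regular language $R\subseteq A^\ast$ and a word $w\in A^\ast$, decide whether $\pi(w)\in\pi(R)$. Weak compression. Let $M$ be the monoid given by the finite presentation $\mathrm{Mon}\langle A\mid u_i=v_i\ (1\le i\le p)\rangle$. A pair $(u,v)$ is sealed by $w\in A^+$ if $u,v\in wA^\ast\cap A^\ast w$. $M$ is weakly compressible (with respect to $\alpha$) if there is a self-overlap free word $\alpha\in A^+$ such that every pair $(u_i,v_i)$ is sealed by $\alpha$. Let $\Sigma_\ast=\alpha(A^\ast\setminus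 A^\ast\alpha A^\ast)$; this is a suffix code. Let $\Gamma_\ast=\{\gamma_w : w\in\Sigma_\ast\}$ be a set of symbols in bijection with $\Sigma_\ast$, and let $\varphi\colon\Sigma_\ast^\ast\to\Gamma_\ast^\ast$ be the isomorphism of free monoids with $w\mapsto\gamma_w$ for $w\in\Sigma_\ast$. Each $u_i,v_i$ lies in $\Sigma_\ast^\ast\alpha$; factor uniquely $u_i\equiv u_{i,1}\cdots u_{i,m_i}\alpha$ and $v_i\equiv v_{i,1}\cdots v_{i,n_i}\alpha$ with all $u_{i,j},v_{i,k}\in\Sigma_\ast$. Let $\Sigma\subseteq\Sigma_\ast$ be the finite set of all the words $u_{i,j},v_{i,k}$ and $\Gamma=\varphi(\Sigma)$. The extended left monoid is $L_\ast(M)=\mathrm{Mon}\langle\Gamma_\ast\mid\varphi(u_{i,1}\cdots u_{i,m_i})=\varphi(v_{i,1}\cdots v_{i,n_i})\ (1\le i\le p)\rangle$, and the left monoid $L(M)$ is the submonoid of $L_\ast(M)$ generated by $\Gamma$; it has the finite presentation with generating set $\Gamma$ and the same defining relations. *)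

theory Defs
  imports "HOL-Algebra.Group" "HOL-Library.Sublist" "HOL-Library.Nat_Bijection"
begin

section \<open>Decidability\<close>

text \<open>Kleene's partial recursive functions. \<open>computes f xs y\<close> means that \<open>f\<close> is defined on the
  argument tuple \<open>xs\<close> and has the value \<open>y\<close> there.\<close>

datatype recf =
    Zero
  | Succ
  | Proj nat
  | Comp recf "recf list"
  | PrimRec recf recf
  | Mu recf

inductive computes :: "recf \<Rightarrow> nat list \<Rightarrow> nat \<Rightarrow> bool" where
  Zero: "computes Zero xs 0"
| Succ: "computes Succ [x] (Suc x)"
| Proj: "i < length xs \<Longrightarrow> computes (Proj i) xs (xs ! i)"
| Comp: "list_all2 (\<lambda>g y. computes g xs y) gs ys \<Longrightarrow> computes f ys z \<Longrightarrow> computes (Comp f gs) xs z"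
| PrimRec_0: "computes f xs y \<Longrightarrow> computes (PrimRec f g) (0 # xs) y"
| PrimRec_Suc: "computes (PrimRec f g) (n # xs) y \<Longrightarrow> computes g (n # y # xs) z
    \<Longrightarrow> computes (PrimRec f g) (Suc n # xs) z"
| Mu: "computes f (n # xs) 0 \<Longrightarrow> (\<forall>k<n. \<exists>y. computes f (k # xs) (Suc y))
    \<Longrightarrow> computes (Mu f) xs n"

inductive_cases computes_elims:
  "computes Zero xs y" "computes Succ xs y" "computes (Proj i) xs y" "computes (Comp f gs) xs y"
  "computes (PrimRec f g) (0 # xs) y" "computes (PrimRec f g) (Suc n # xs) y" "computes (Mu f) xs y"

lemma computes_deterministic:
  "computes f xs y \<Longrightarrow> computes f xs z \<Longrightarrow> y = z"
proof (induction arbitrary: z rule: computes.induct)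
  case (Comp xs gs ys f y)
  from Comp.prems obtain ys' where
    ys': "list_all2 (\<lambda>g y. computes g xs y) gs ys'" "computes f ys' z"
    by (rule computes_elims(4))
  have "ys = ys'"
    using Comp.IH(1) ys'(1) by (simp add: list_all2_conv_all_nth list_eq_iff_nth_eq)
  then show ?case using Comp.IH(2)[of z] ys'(2) by simp
next
  case (PrimRec_0 f xs y g)
  from PrimRec_0.prems have "computes f xs z" by (rule computes_elims(5))
  then show ?case by (rule PrimRec_0.IH)
next
  case (PrimRec_Suc f g n xs y y')
  from PrimRec_Suc.prems obtain x where
    x: "computes (PrimRec f g) (n # xs) x" "computes g (n # x # xs) z"
    by (rule computes_elims(6))
  from PrimRec_Suc.IH(1)[OF x(1)] x(2) have "computes g (n # y # xs) z" by simp
  then show ?case by (rule PrimRec_Suc.IH(2))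
next
  case (Mu f n xs)
  have z: "computes f (z # xs) 0" "\<forall>k<z. \<exists>y. computes f (k # xs) (Suc y)"
    by (rule computes_elims(7)[OF Mu.prems], assumption)+
  have "\<not> n < z"
  proof
    assume "n < z"
    with z(2) obtain y where "computes f (n # xs) (Suc y)" by blast
    from Mu.IH(1)[OF this] show False by simp
  qed
  moreover have "\<not> z < n"
  proof
    assume "z < n"
    with Mu.IH(2) obtain y where "\<forall>x. computes f (z # xs) x \<longrightarrow> Suc y = x" by blast
    with z(1) show False by blast
  qed
  ultimately show ?case by simp
qed (erule computes_elims(1-3), simp)+

definition decidable :: "nat set \<Rightarrow> bool" where
  "decidable X \<longleftrightarrow> (\<exists>f. \<forall>n. computes f [n] (if n \<in> X then 1 else 0))"


section \<open>Regular and context-free languages\<close>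

text \<open>Nondeterministic finite automata, given by their initial states, transitions and final
  states; a regular language is presented to an algorithm by such an automaton.\<close>

datatype 'a nfa =
  NFA (initial: "nat list") (transitions: "(nat \<times> 'a \<times> nat) list") (final: "nat list")

inductive nfa_path :: "'a nfa \<Rightarrow> nat \<Rightarrow> 'a list \<Rightarrow> nat \<Rightarrow> bool" for \<A> where
  Nil: "nfa_path \<A> p [] p"
| Cons: "(p, a, q) \<in> set (transitions \<A>) \<Longrightarrow> nfa_path \<A> q w r \<Longrightarrow> nfa_path \<A> p (a # w) r"

definition nfa_lang :: "'a nfa \<Rightarrow> 'a list set" where
  "nfa_lang \<A> = {w. \<exists>p \<in> set (initial \<A>). \<exists>q \<in> set (final \<A>). nfa_path \<A> p w q}"

definition nfa_over :: "'a set \<Rightarrow> 'a nfa \<Rightarrow> bool" where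
  "nfa_over A \<A> \<longleftrightarrow> (\<forall>(p, a, q) \<in> set (transitions \<A>). a \<in> A)"

datatype ('n, 't) sym = Nt 'n | Tm 't

type_synonym ('n, 't) prods = "('n \<times> ('n, 't) sym list) set"

inductive derives1 :: "('n, 't) prods \<Rightarrow> ('n, 't) sym list \<Rightarrow> ('n, 't) sym list \<Rightarrow> bool" for P where
  "(X, \<beta>) \<in> P \<Longrightarrow> derives1 P (x @ [Nt X] @ y) (x @ \<beta> @ y)"

definition cfg_lang :: "('n, 't) prods \<Rightarrow> 'n \<Rightarrow> 't list set" where
  "cfg_lang P S = {w. (derives1 P)\<^sup>*\<^sup>* [Nt S] (map Tm w)}"

text \<open>As a grammar has only finitely many productions, its nonterminals may be taken to be natural
  numbers.\<close>

definition context_free :: "'t list set \<Rightarrow> bool" where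
  "context_free L \<longleftrightarrow> (\<exists>(P :: (nat, 't) prods) S. finite P \<and> L = cfg_lang P S)"


section \<open>Generated and presented monoids\<close>

definition free_monoid :: "'a set \<Rightarrow> 'a list monoid" where
  "free_monoid A = \<lparr>carrier = lists A, mult = (@), one = []\<rparr>"

definition finitely_generated_via :: "('m, 'z) monoid_scheme \<Rightarrow> 'b set \<Rightarrow> ('b list \<Rightarrow> 'm) \<Rightarrow> bool" where
  "finitely_generated_via N B \<pi> \<longleftrightarrow> finite B \<and> \<pi> \<in> hom (free_monoid B) N \<and>
     \<pi> \<one>\<^bsub>free_monoid B\<^esub> = \<one>\<^bsub>N\<^esub> \<and> \<pi> ` carrier (free_monoid B) = carrier N"

text \<open>The separating symbol \<open>#\<close> is \<^term>\<open>None\<close>.\<close>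

definition word_problem :: "'b set \<Rightarrow> ('b list \<Rightarrow> 'm) \<Rightarrow> 'b option list set" where
  "word_problem B \<pi> =
     {map Some u @ [None] @ rev (map Some v) | u v. u \<in> lists B \<and> v \<in> lists B \<and> \<pi> u = \<pi> v}"

inductive_set pres_cong :: "'a set \<Rightarrow> ('a list \<times> 'a list) set \<Rightarrow> ('a list \<times> 'a list) set"
  for A R where
  refl: "w \<in> lists A \<Longrightarrow> (w, w) \<in> pres_cong A R"
| rel: "(u, v) \<in> R \<Longrightarrow> p \<in> lists A \<Longrightarrow> s \<in> lists A \<Longrightarrow> (p @ u @ s, p @ v @ s) \<in> pres_cong A R"
| sym: "(u, v) \<in> pres_cong A R \<Longrightarrow> (v, u) \<in> pres_cong A R"
| trans: "(u, v) \<in> pres_cong A R \<Longrightarrow> (v, w) \<in> pres_cong A R \<Longrightarrow> (u, w) \<in> pres_cong A R"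

definition word_class :: "'a set \<Rightarrow> ('a list \<times> 'a list) set \<Rightarrow> 'a list \<Rightarrow> 'a list set" where
  "word_class A R w = pres_cong A R `` {w}"

definition presented_monoid :: "'a set \<Rightarrow> ('a list \<times> 'a list) set \<Rightarrow> 'a list set monoid" where
  "presented_monoid A R =
     \<lparr>carrier = lists A // pres_cong A R,
      mult = (\<lambda>X Y. \<Union>x\<in>X. \<Union>y\<in>Y. word_class A R (x @ y)),
      one = word_class A R []\<rparr>"

definition finite_presentation :: "'a set \<Rightarrow> ('a list \<times> 'a list) set \<Rightarrow> bool" where
  "finite_presentation A R \<longleftrightarrow> finite A \<and> finite R \<and> R \<subseteq> lists A \<times> lists A"

lemma pres_cong_append:
  assumes "R \<subseteq> lists A \<times> lists A" "(u, v) \<in> pres_cong A R" "x \<in> lists A" "y \<in> lists A"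
  shows "(x @ u @ y, x @ v @ y) \<in> pres_cong A R"
  using assms(2)
proof induction
  case (refl w)
  then show ?case using assms(3,4) by (intro pres_cong.refl) auto
next
  case (rel u v p s)
  then show ?case using assms(3,4) pres_cong.rel[of u v R "x @ p" A "s @ y"] by simp
qed (blast intro: pres_cong.sym pres_cong.trans)+

lemma equiv_pres_cong:
  assumes "R \<subseteq> lists A \<times> lists A"
  shows "equiv (lists A) (pres_cong A R)"
proof (rule equivI)
  have "u \<in> lists A \<and> v \<in> lists A" if "(u, v) \<in> pres_cong A R" for u v
    using that by induction (use assms in auto)
  then show "pres_cong A R \<subseteq> lists A \<times> lists A" by auto
  show "refl_on (lists A) (pres_cong A R)"
    by (auto intro!: refl_onI pres_cong.refl)
qed (auto intro!: symI transI intro: pres_cong.sym pres_cong.trans)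

lemma mult_word_class:
  assumes "R \<subseteq> lists A \<times> lists A" "u \<in> lists A" "v \<in> lists A"
  shows "word_class A R u \<otimes>\<^bsub>presented_monoid A R\<^esub> word_class A R v = word_class A R (u @ v)"
proof -
  note eq = equiv_pres_cong[OF assms(1)]
  have "word_class A R (x @ y) = word_class A R (u @ v)"
    if "x \<in> word_class A R u" "y \<in> word_class A R v" for x y
  proof -
    have xy: "(u, x) \<in> pres_cong A R" "(v, y) \<in> pres_cong A R"
      using that by (auto simp: word_class_def)
    then have "x \<in> lists A" using eq by (auto simp: equiv_def)
    then have "(u @ v, x @ y) \<in> pres_cong A R"
      using pres_cong_append[OF assms(1) xy(1), of "[]" v]
        pres_cong_append[OF assms(1) xy(2), of x "[]"] assms(3)
      by (auto intro: pres_cong.trans)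
    then show ?thesis
      unfolding word_class_def using equiv_class_eq[OF eq] by blast
  qed
  moreover have "u \<in> word_class A R u" "v \<in> word_class A R v"
    using assms(2,3) by (auto simp: word_class_def intro: pres_cong.refl)
  ultimately have "(\<Union>x\<in>word_class A R u. \<Union>y\<in>word_class A R v. word_class A R (x @ y)) =
      word_class A R (u @ v)"
    by blast
  then show ?thesis by (simp add: presented_monoid_def)
qed

lemma finitely_generated_via_word_class:
  assumes "finite A" "R \<subseteq> lists A \<times> lists A"
  shows "finitely_generated_via (presented_monoid A R) A (word_class A R)"
proof -
  have img: "word_class A R ` lists A = carrier (presented_monoid A R)"
    by (simp add: presented_monoid_def quotient_def word_class_def UNION_singleton_eq_range)
  then have "word_class A R \<in> hom (free_monoid A) (presented_monoid A R)"
    using mult_word_class[OF assms(2)]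
    by (intro homI) (simp_all add: free_monoid_def flip: img)
  then show ?thesis
    using assms(1) img
    by (simp add: finitely_generated_via_def free_monoid_def) (simp add: presented_monoid_def)
qed


section \<open>The rational subset membership problem\<close>

text \<open>Instances are encoded as natural numbers by means of a numbering \<open>c\<close> of the letters. The
  alphabet being finite, the choice of the numbering is irrelevant.\<close>

definition encode_nfa :: "('a \<Rightarrow> nat) \<Rightarrow> 'a nfa \<Rightarrow> nat" where
  "encode_nfa c \<A> =
     prod_encode (list_encode (initial \<A>),
       prod_encode (list_encode (map (\<lambda>(p, a, q). prod_encode (p, prod_encode (c a, q))) (transitions \<A>)),
         list_encode (final \<A>)))"

definition encode_instance :: "('a \<Rightarrow> nat) \<Rightarrow> 'a nfa \<Rightarrow> 'a list \<Rightarrow> nat" where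
  "encode_instance c \<A> w = prod_encode (encode_nfa c \<A>, list_encode (map c w))"

definition rational_subset_membership_decidable :: "'a set \<Rightarrow> ('a list \<Rightarrow> 'm) \<Rightarrow> bool" where
  "rational_subset_membership_decidable A \<pi> \<longleftrightarrow>
     (\<forall>c. inj_on c A \<longrightarrow>
        decidable {encode_instance c \<A> w | \<A> w.
          nfa_over A \<A> \<and> w \<in> lists A \<and> \<pi> w \<in> \<pi> ` nfa_lang \<A>})"


section \<open>Weak compression and the left monoid\<close>

definition self_overlap_free :: "'a list \<Rightarrow> bool" where
  "self_overlap_free w \<longleftrightarrow> w = [] \<or> \<not> (\<exists>x. x \<noteq> [] \<and> strict_prefix x w \<and> strict_suffix x w)"

definition sealed :: "'a list \<Rightarrow> 'a list \<times> 'a list \<Rightarrow> bool" where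
  "sealed w = (\<lambda>(u, v). prefix w u \<and> suffix w u \<and> prefix w v \<and> suffix w v)"

definition weakly_compressible_wrt :: "'a set \<Rightarrow> ('a list \<times> 'a list) set \<Rightarrow> 'a list \<Rightarrow> bool" where
  "weakly_compressible_wrt A R \<alpha> \<longleftrightarrow>
     \<alpha> \<in> lists A \<and> \<alpha> \<noteq> [] \<and> self_overlap_free \<alpha> \<and> (\<forall>r\<in>R. sealed \<alpha> r)"

text \<open>The set \<open>\<alpha> (A\<^sup>* - A\<^sup>* \<alpha> A\<^sup>*)\<close>.\<close>

definition Sigma_star :: "'a set \<Rightarrow> 'a list \<Rightarrow> 'a list set" where
  "Sigma_star A \<alpha> = {\<alpha> @ x | x. x \<in> lists A \<and> \<not> sublist \<alpha> x}"

text \<open>The symbol \<open>\<gamma>\<^sub>w\<close> for \<open>w \<in> \<Sigma>\<^sub>*\<close> is the word \<open>w\<close> itself, so a word over \<open>\<Gamma>\<^sub>*\<close> is a list of words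
  and \<open>\<phi>\<close> is the inverse of \<^const>\<open>concat\<close>: it sends \<open>w\<^sub>1 \<cdots> w\<^sub>k\<close> to \<open>[w\<^sub>1, \<dots>, w\<^sub>k]\<close>. In particular
  \<open>\<Gamma>\<^sub>* = \<Sigma>\<^sub>*\<close> and \<open>\<Gamma> = \<Sigma>\<close>. The factorisation of the two sides of a relation is unique, hence each
  relation contributes exactly one pair.\<close>

definition left_rels :: "'a set \<Rightarrow> ('a list \<times> 'a list) set \<Rightarrow> 'a list \<Rightarrow> ('a list list \<times> 'a list list) set" where
  "left_rels A R \<alpha> =
     {(us, vs). us \<in> lists (Sigma_star A \<alpha>) \<and> vs \<in> lists (Sigma_star A \<alpha>) \<and>
        (concat us @ \<alpha>, concat vs @ \<alpha>) \<in> R}"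

definition left_alphabet :: "'a set \<Rightarrow> ('a list \<times> 'a list) set \<Rightarrow> 'a list \<Rightarrow> 'a list set" where
  "left_alphabet A R \<alpha> = (\<Union>(us, vs) \<in> left_rels A R \<alpha>. set us \<union> set vs)"

definition extended_left_monoid ::
    "'a set \<Rightarrow> ('a list \<times> 'a list) set \<Rightarrow> 'a list \<Rightarrow> 'a list list set monoid" where
  "extended_left_monoid A R \<alpha> = presented_monoid (Sigma_star A \<alpha>) (left_rels A R \<alpha>)"

definition submonoid_generated :: "('m, 'z) monoid_scheme \<Rightarrow> 'm set \<Rightarrow> 'm set" where
  "submonoid_generated N X = \<Inter>{H. submonoid H N \<and> X \<subseteq> H}"

definition left_monoid ::
    "'a set \<Rightarrow> ('a list \<times> 'a list) set \<Rightarrow> 'a list \<Rightarrow> 'a list list set monoid" where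
  "left_monoid A R \<alpha> = (extended_left_monoid A R \<alpha>)
     \<lparr>carrier := submonoid_generated (extended_left_monoid A R \<alpha>)
        {word_class (Sigma_star A \<alpha>) (left_rels A R \<alpha>) [\<gamma>] | \<gamma>. \<gamma> \<in> left_alphabet A R \<alpha>}\<rparr>"

end

theory Submission
  imports Defs
begin

text \<open>The word problem of \<open>M\<close> is itself context-free. Two words are equal in \<open>M\<close> iff they arise from
  the pair of empty words by prefixing both with the same letter, or with \<open>x \<alpha>\<close> and \<open>y \<alpha>\<close>
  respectively, where \<open>x\<close> and \<open>y\<close> are words over \<open>\<Sigma>\<close> that are equal in \<open>L(M)\<close>: the word \<open>\<alpha> w\<close>
  factors uniquely over \<open>\<Sigma>\<^sub>*\<close>, the defining relations of \<open>M\<close> only affect the factors strictly between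
  the first and the last one, and \<open>L\<^sub>*(M)\<close> is the free product of \<open>L(M)\<close> with the free monoid on
  \<open>\<Gamma>\<^sub>* - \<Gamma>\<close>. A rational transduction turns the word problem of \<open>L(M)\<close> into the language
  of the words \<open>x # y\<^sup>r\<close>; substituting \<open>\<alpha> S \<alpha>\<^sup>r\<close> for \<open>#\<close> in a grammar for it and adding
  the productions \<open>S \<rightarrow> a S a\<close> and \<open>S \<rightarrow> #\<close> gives a grammar for the word problem of \<open>M\<close>.

  A word \<open>w\<close> then represents an element of the image of a regular language \<open>R\<close> iff the word problem
  meets the regular language \<open>R # w\<^sup>r\<close>. Which pairs of states are joined by a word derived from which
  nonterminal is the least solution of a finite system of closure conditions, so non-reachability
  is witnessed by a closed table of bounded code, and the question is settled by bounded search.\<close>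

section \<open>Recursive functions and predicates\<close>

definition ncomputable :: "nat \<Rightarrow> (nat list \<Rightarrow> nat) \<Rightarrow> bool" where
  "ncomputable n f \<longleftrightarrow> (\<exists>r. \<forall>xs. length xs = n \<longrightarrow> computes r xs (f xs))"

lemma ncomputable_cong:
  "(\<And>xs. length xs = n \<Longrightarrow> f xs = g xs) \<Longrightarrow> ncomputable n f \<longleftrightarrow> ncomputable n g"
  by (simp add: ncomputable_def)

lemma ncomputable_proj: "i < n \<Longrightarrow> ncomputable n (\<lambda>xs. xs ! i)"
  unfolding ncomputable_def by (auto intro!: exI[of _ "Proj i"] computes.Proj)

lemma ncomputable_comp:
  assumes "ncomputable (length gs) f" "\<And>g. g \<in> set gs \<Longrightarrow> ncomputable n g"
  shows "ncomputable n (\<lambda>xs. f (map (\<lambda>g. g xs) gs))"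
proof -
  from assms(1) obtain r where r: "\<And>xs. length xs = length gs \<Longrightarrow> computes r xs (f xs)"
    by (auto simp: ncomputable_def)
  from assms(2) obtain h where
    h: "\<And>g xs. g \<in> set gs \<Longrightarrow> length xs = n \<Longrightarrow> computes (h g) xs (g xs)"
    unfolding ncomputable_def by metis
  have "computes (Comp r (map h gs)) xs (f (map (\<lambda>g. g xs) gs))" if "length xs = n" for xs
    by (rule computes.Comp[where ys = "map (\<lambda>g. g xs) gs"])
       (use that h r in \<open>auto simp: list_all2_conv_all_nth\<close>)
  then show ?thesis by (auto simp: ncomputable_def)
qed

lemma ncomputable_0: "ncomputable n (\<lambda>xs. 0)"
  unfolding ncomputable_def by (auto intro!: exI[of _ Zero] computes.Zero)

lemma ncomputable_Suc: "ncomputable n f \<Longrightarrow> ncomputable n (\<lambda>xs. Suc (f xs))"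
proof -
  have "ncomputable 1 (\<lambda>xs. Suc (hd xs))"
    unfolding ncomputable_def
    by (auto intro!: exI[of _ Succ] simp: length_Suc_conv intro: computes.Succ)
  then show "ncomputable n f \<Longrightarrow> ?thesis"
    using ncomputable_comp[of "[f]" "\<lambda>xs. Suc (hd xs)" n] by simp
qed

lemma ncomputable_rec:
  assumes "ncomputable n f" "ncomputable (n + 2) g" "ncomputable n k"
  shows "ncomputable n (\<lambda>xs. rec_nat (f xs) (\<lambda>m y. g (m # y # xs)) (k xs))"
proof -
  define h where "h xs = rec_nat (f (tl xs)) (\<lambda>m y. g (m # y # tl xs)) (hd xs)" for xs
  from assms(1) obtain r where r: "\<And>xs. length xs = n \<Longrightarrow> computes r xs (f xs)"
    by (auto simp: ncomputable_def)
  from assms(2) obtain s where s: "\<And>xs. length xs = n + 2 \<Longrightarrow> computes s xs (g xs)"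
    by (auto simp: ncomputable_def)
  have "computes (PrimRec r s) (m # xs) (h (m # xs))" if "length xs = n" for m xs
    by (induction m) (use r s that in \<open>auto simp: h_def intro!: computes.intros\<close>)
  then have "ncomputable (Suc n) h"
    unfolding ncomputable_def by (auto simp: length_Suc_conv intro!: exI[of _ "PrimRec r s"])
  \<comment> \<open>\<open>PrimRec\<close> takes its counter from the head of the tuple, so it is
    composed with \<open>k\<close> followed by all projections, which hand on the parameters
    unchanged.\<close>
  moreover have "ncomputable n g" if "g \<in> set (k # map (\<lambda>i xs. xs ! i) [0..<n])" for g
    using that assms(3) by (auto intro: ncomputable_proj)
  ultimately have "ncomputable n (\<lambda>xs. h (map (\<lambda>g. g xs) (k # map (\<lambda>i xs. xs ! i) [0..<n])))"
    by (intro ncomputable_comp) auto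
  moreover have "map (\<lambda>g. g xs) (map (\<lambda>i xs. xs ! i) [0..<n]) = xs" if "length xs = n" for xs :: "nat list"
    using that by (auto intro: nth_equalityI)
  ultimately show ?thesis
    by (subst ncomputable_cong[where g = "\<lambda>xs. h (map (\<lambda>g. g xs) (k # map (\<lambda>i xs. xs ! i) [0..<n]))"])
       (auto simp: h_def simp del: map_map)
qed

text \<open>The existence of a zero makes the search total; below the least zero the values are
  successors, as \<open>Mu\<close> demands, by minimality.\<close>

lemma ncomputable_Least:
  assumes "ncomputable (Suc n) f" "\<And>xs. length xs = n \<Longrightarrow> \<exists>m. f (m # xs) = 0"
  shows "ncomputable n (\<lambda>xs. LEAST m. f (m # xs) = 0)"
proof -
  from assms(1) obtain r where r: "\<And>xs. length xs = Suc n \<Longrightarrow> computes r xs (f xs)"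
    by (auto simp: ncomputable_def)
  have "computes (Mu r) xs (LEAST m. f (m # xs) = 0)" if len: "length xs = n" for xs
  proof (rule computes.Mu)
    have "f ((LEAST m. f (m # xs) = 0) # xs) = 0" using assms(2)[OF len] by (rule LeastI_ex)
    then show "computes r ((LEAST m. f (m # xs) = 0) # xs) 0"
      using r[of "(LEAST m. f (m # xs) = 0) # xs"] len by simp
    show "\<forall>k<LEAST m. f (m # xs) = 0. \<exists>y. computes r (k # xs) (Suc y)"
    proof (intro allI impI)
      fix k assume "k < (LEAST m. f (m # xs) = 0)"
      then have "f (k # xs) \<noteq> 0" by (rule not_less_Least)
      then show "\<exists>y. computes r (k # xs) (Suc y)"
        using r[of "k # xs"] len by (metis length_Cons not0_implies_Suc)
    qed
  qed
  then show ?thesis by (auto simp: ncomputable_def)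
qed

section \<open>Arithmetic and the Cantor pairing\<close>

lemma ncomputable_add:
  assumes "ncomputable n f" "ncomputable n g"
  shows "ncomputable n (\<lambda>xs. f xs + g xs)"
proof -
  have "rec_nat b (\<lambda>m y. Suc y) a = a + b" for a b :: nat by (induction a) auto
  then show ?thesis
    using ncomputable_rec[OF assms(2) ncomputable_Suc[OF ncomputable_proj[of 1]] assms(1)] by simp
qed

lemma ncomputable_pred:
  assumes "ncomputable n f"
  shows "ncomputable n (\<lambda>xs. f xs - 1)"
proof -
  have "rec_nat 0 (\<lambda>m y. m) a = a - 1" for a :: nat by (cases a) auto
  then show ?thesis
    using ncomputable_rec[OF ncomputable_0 ncomputable_proj[of 0] assms] by simp
qed

lemma ncomputable_diff:
  assumes "ncomputable n f" "ncomputable n g"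
  shows "ncomputable n (\<lambda>xs. f xs - g xs)"
proof -
  have "rec_nat a (\<lambda>m y. y - Suc 0) b = a - b" for a b :: nat by (induction b) auto
  then show ?thesis
    using ncomputable_rec[OF assms(1) ncomputable_pred[OF ncomputable_proj[of 1]] assms(2)] by simp
qed

lemma ncomputable_triangle:
  assumes "ncomputable n f"
  shows "ncomputable n (\<lambda>xs. triangle (f xs))"
proof -
  have "rec_nat 0 (\<lambda>m y. y + Suc m) a = triangle a" for a by (induction a) auto
  moreover have "ncomputable (n + 2) (\<lambda>xs. xs ! 1 + Suc (xs ! 0))"
    by (intro ncomputable_add ncomputable_Suc ncomputable_proj) auto
  ultimately show ?thesis
    using ncomputable_rec[OF ncomputable_0 _ assms, of "\<lambda>xs. xs ! 1 + Suc (xs ! 0)"] by simp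
qed

abbreviation pair :: "nat \<Rightarrow> nat \<Rightarrow> nat" where "pair m n \<equiv> prod_encode (m, n)"
definition pfst :: "nat \<Rightarrow> nat" where "pfst z = fst (prod_decode z)"
definition psnd :: "nat \<Rightarrow> nat" where "psnd z = snd (prod_decode z)"

lemma pfst_pair [simp]: "pfst (pair m n) = m" and psnd_pair [simp]: "psnd (pair m n) = n"
  by (simp_all add: pfst_def psnd_def)

lemma pair_pfst_psnd [simp]: "pair (pfst z) (psnd z) = z"
  by (simp add: pfst_def psnd_def)

lemma pfst_le: "pfst z \<le> z" and psnd_le: "psnd z \<le> z"
  using le_prod_encode_1[of "pfst z" "psnd z"] le_prod_encode_2[of "psnd z" "pfst z"] by simp_all

lemma triangle_mono: "m \<le> n \<Longrightarrow> triangle m \<le> triangle n"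
  by (induction n) (auto simp: le_Suc_eq)

lemma le_triangle: "n \<le> triangle n"
  by (induction n) auto

lemma prod_encode_eq_triangle: "pair m n = triangle (m + n) + m"
  by (simp add: prod_encode_def)

lemma ncomputable_pair:
  "ncomputable n f \<Longrightarrow> ncomputable n g \<Longrightarrow> ncomputable n (\<lambda>xs. pair (f xs) (g xs))"
  unfolding prod_encode_eq_triangle by (simp add: ncomputable_add ncomputable_triangle)

lemma triangle_plus_pfst: "triangle (pfst z + psnd z) + pfst z = z"
  by (metis pair_pfst_psnd prod_encode_eq_triangle)

text \<open>The numbers on the diagonal \<open>k = pfst z + psnd z\<close> run from
  \<open>triangle k\<close> to just below \<open>triangle (Suc k)\<close>. Hence \<open>k\<close> is
  least with \<open>z < triangle (Suc k)\<close>, and truncated subtraction turns this inequality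
  into a zero that \<open>Mu\<close> can find.\<close>

lemma diagonal_Least:
  "(LEAST k. Suc z - triangle (Suc k) = 0) = pfst z + psnd z"
proof (rule Least_equality)
  have "z < triangle (Suc (pfst z + psnd z))"
    using triangle_plus_pfst[of z] unfolding triangle_Suc by linarith
  then show "Suc z - triangle (Suc (pfst z + psnd z)) = 0"
    by (simp only: Suc_le_eq diff_is_0_eq)
  fix k assume "Suc z - triangle (Suc k) = 0"
  then have "z < triangle (Suc k)" by (simp only: Suc_le_eq diff_is_0_eq)
  then have "triangle (pfst z + psnd z) < triangle (Suc k)"
    using triangle_plus_pfst[of z] by linarith
  then have "pfst z + psnd z < Suc k" 
    using triangle_mono[of "Suc k" "pfst z + psnd z"] by linarith
  then show "pfst z + psnd z \<le> k" by simp
qed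

lemma ncomputable_diagonal: "ncomputable 1 (\<lambda>xs. pfst (xs ! 0) + psnd (xs ! 0))"
proof -
  have "ncomputable (Suc 1) (\<lambda>xs. Suc (xs ! 1) - triangle (Suc (xs ! 0)))"
    by (intro ncomputable_diff ncomputable_Suc ncomputable_proj ncomputable_triangle) auto
  then have "ncomputable 1 (\<lambda>xs. LEAST m. Suc ((m # xs) ! 1) - triangle (Suc ((m # xs) ! 0)) = 0)"
  proof (rule ncomputable_Least)
    \<comment> \<open>The code itself is a large enough diagonal, as a triangular number is at least
      its index.\<close>
    show "\<exists>m. Suc ((m # xs) ! 1) - triangle (Suc ((m # xs) ! 0)) = 0" for xs
      by (rule exI[of _ "xs ! 0"]) (use le_triangle[of "Suc (xs ! 0)"] in simp)
  qed
  then show ?thesis by (simp add: diagonal_Least del: triangle_Suc diff_is_0_eq)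
qed

lemma ncomputable_pfst: "ncomputable 1 (\<lambda>xs. pfst (xs ! 0))"
proof -
  have "ncomputable 1 (\<lambda>xs. xs ! 0 - triangle (pfst (xs ! 0) + psnd (xs ! 0)))"
    by (intro ncomputable_diff ncomputable_triangle ncomputable_diagonal ncomputable_proj) simp
  moreover have "z - triangle (pfst z + psnd z) = pfst z" for z
    using triangle_plus_pfst[of z] by linarith
  ultimately show ?thesis by simp
qed

section \<open>Unary computable functions and recursive predicates\<close>

definition computable :: "(nat \<Rightarrow> nat) \<Rightarrow> bool" where
  "computable f \<longleftrightarrow> ncomputable 1 (\<lambda>xs. f (xs ! 0))"

definition recursive :: "(nat \<Rightarrow> bool) \<Rightarrow> bool" where
  "recursive P \<longleftrightarrow> computable (\<lambda>x. if P x then 1 else 0)"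

lemma recursive_imp_decidable:
  assumes "recursive P"
  shows "decidable {x. P x}"
proof -
  from assms obtain r where
    r: "\<And>xs. length xs = 1 \<Longrightarrow> computes r xs (if P (xs ! 0) then 1 else 0)"
    by (auto simp: recursive_def computable_def ncomputable_def)
  have "computes r [n] (if n \<in> {x. P x} then 1 else 0)" for n
    using r[of "[n]"] by simp
  then show ?thesis unfolding decidable_def by blast
qed

lemma ncomputable_compose:
  assumes "computable f" "ncomputable n g"
  shows "ncomputable n (\<lambda>xs. f (g xs))"
  using ncomputable_comp[of "[g]" "\<lambda>xs. f (xs ! 0)" n] assms by (simp add: computable_def)

lemma computable_compose: "computable f \<Longrightarrow> computable g \<Longrightarrow> computable (\<lambda>x. f (g x))"
  unfolding computable_def[of g] computable_def[of "\<lambda>x. f (g x)"] by (rule ncomputable_compose)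

named_theorems computable

lemma computable_id [computable]: "computable (\<lambda>x. x)"
  by (simp add: computable_def ncomputable_proj)

lemma computable_Suc [computable]: "computable f \<Longrightarrow> computable (\<lambda>x. Suc (f x))"
  unfolding computable_def by (rule ncomputable_Suc)

lemma computable_const [computable]: "computable (\<lambda>x. k)"
proof (induction k)
  case 0
  then show ?case by (simp add: computable_def ncomputable_0)
qed (rule computable_Suc)

lemma computable_add [computable]:
  "computable f \<Longrightarrow> computable g \<Longrightarrow> computable (\<lambda>x. f x + g x)"
  unfolding computable_def by (rule ncomputable_add)

lemma computable_diff [computable]:
  "computable f \<Longrightarrow> computable g \<Longrightarrow> computable (\<lambda>x. f x - g x)"
  unfolding computable_def by (rule ncomputable_diff)

lemma computable_pair [computable]:
  "computable f \<Longrightarrow> computable g \<Longrightarrow> computable (\<lambda>x. pair (f x) (g x))"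
  unfolding computable_def by (rule ncomputable_pair)

lemma computable_pfst [computable]: "computable f \<Longrightarrow> computable (\<lambda>x. pfst (f x))"
  by (rule computable_compose) (simp_all add: computable_def ncomputable_pfst[simplified])

lemma computable_psnd [computable]: "computable f \<Longrightarrow> computable (\<lambda>x. psnd (f x))"
proof -
  have "computable (\<lambda>x. (pfst x + psnd x) - pfst x)"
    using ncomputable_diff[OF ncomputable_diagonal ncomputable_pfst] by (simp add: computable_def)
  then show "computable f \<Longrightarrow> ?thesis" by (simp add: computable_compose)
qed

text \<open>In the unary setting several arguments are packed into one number; the step function
  receives counter, previous value and parameter as \<open>pair m (pair y x)\<close>.\<close>

lemma computable_rec:
  assumes "computable f" "computable (\<lambda>z. g (psnd (psnd z)) (pfst z) (pfst (psnd z)))" "computable k"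
  shows "computable (\<lambda>x. rec_nat (f x) (g x) (k x))"
proof -
  have "ncomputable 3 (\<lambda>xs. (\<lambda>z. g (psnd (psnd z)) (pfst z) (pfst (psnd z)))
      (pair (xs ! 0) (pair (xs ! 1) (xs ! 2))))"
    using assms(2) by (rule ncomputable_compose) (intro ncomputable_pair ncomputable_proj; simp)
  then have "ncomputable (1 + 2) (\<lambda>xs. g (xs ! 2) (xs ! 0) (xs ! 1))"
    by (simp add: numeral_eq_Suc)
  from ncomputable_rec[OF _ this, of "\<lambda>xs. f (xs ! 0)" "\<lambda>xs. k (xs ! 0)"] assms(1,3)
  show ?thesis by (simp add: computable_def)
qed

lemma computable_mult [computable]:
  assumes "computable f" "computable g"
  shows "computable (\<lambda>x. f x * g x)"
proof -
  have "rec_nat 0 (\<lambda>m y. b + y) a = a * b" for a b :: nat by (induction a) auto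
  moreover have "computable (\<lambda>x. rec_nat 0 (\<lambda>m y. g x + y) (f x))"
    by (intro computable_rec computable computable_compose[OF assms(2)] assms(1))
  ultimately show ?thesis by simp
qed

lemma computable_power2 [computable]:
  assumes "computable f"
  shows "computable (\<lambda>x. 2 ^ f x)"
proof -
  have "rec_nat 1 (\<lambda>m y. 2 * y) a = (2 :: nat) ^ a" for a by (induction a) auto
  moreover have "computable (\<lambda>x. rec_nat 1 (\<lambda>m y. 2 * y) (f x))"
    by (intro computable_rec computable assms)
  ultimately show ?thesis by simp
qed

lemma recursive_compose: "recursive P \<Longrightarrow> computable g \<Longrightarrow> recursive (\<lambda>x. P (g x))"
  unfolding recursive_def by (rule computable_compose)

lemma computable_if:
  assumes "recursive P" "computable f" "computable g"
  shows "computable (\<lambda>x. if P x then f x else g x)"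
proof -
  have "computable (\<lambda>x. (if P x then 1 else 0) * f x + (1 - (if P x then 1 else 0)) * g x)"
    using assms unfolding recursive_def by (intro computable) auto
  then show ?thesis by (rule back_subst[of computable]) auto
qed

lemma recursive_const [computable]: "recursive (\<lambda>x. b)"
  unfolding recursive_def by (intro computable)

lemma recursive_le [computable]:
  assumes "computable f" "computable g"
  shows "recursive (\<lambda>x. f x \<le> g x)"
proof -
  have "computable (\<lambda>x. 1 - (f x - g x))" by (intro computable assms)
  then show ?thesis unfolding recursive_def by (rule back_subst[of computable]) auto
qed

lemma recursive_not [computable]:
  assumes "recursive P"
  shows "recursive (\<lambda>x. \<not> P x)"
proof -
  have "computable (\<lambda>x. if P x then 0 else 1)" by (intro computable_if computable assms)
  then show ?thesis unfolding recursive_def by (rule back_subst[of computable]) auto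
qed

lemma recursive_conj [computable]:
  assumes "recursive P" "recursive Q"
  shows "recursive (\<lambda>x. P x \<and> Q x)"
proof -
  have "computable (\<lambda>x. if P x then (if Q x then 1 else 0) else 0)"
    by (intro computable_if computable assms)
  then show ?thesis unfolding recursive_def by (rule back_subst[of computable]) auto
qed

lemma recursive_disj [computable]:
  assumes "recursive P" "recursive Q"
  shows "recursive (\<lambda>x. P x \<or> Q x)"
proof -
  have "recursive (\<lambda>x. \<not> (\<not> P x \<and> \<not> Q x))" by (intro computable assms)
  then show ?thesis by simp
qed

lemma recursive_imp [computable]:
  assumes "recursive P" "recursive Q"
  shows "recursive (\<lambda>x. P x \<longrightarrow> Q x)"
proof -
  have "recursive (\<lambda>x. \<not> P x \<or> Q x)" by (intro computable assms)
  then show ?thesis by simp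
qed

lemma recursive_less [computable]:
  "computable f \<Longrightarrow> computable g \<Longrightarrow> recursive (\<lambda>x. f x < g x)"
  unfolding Suc_le_eq[symmetric] by (intro computable)

lemma recursive_eq [computable]:
  "computable f \<Longrightarrow> computable g \<Longrightarrow> recursive (\<lambda>x. f x = g x)"
  unfolding eq_iff by (intro computable)

lemma recursive_bex [computable]:
  assumes "computable b" "recursive (\<lambda>z. P (psnd z) (pfst z))"
  shows "recursive (\<lambda>x. \<exists>y<b x. P x y)"
proof -
  have "rec_nat 0 (\<lambda>k r. if Q k then 1 else r) n = (if \<exists>y<n. Q y then 1 else 0 :: nat)" for Q and n
    by (induction n) (auto simp: less_Suc_eq)
  \<comment> \<open>A recursion step is given a packed triple, a predicate under a quantifier a
    packed pair with the bound variable first; the reindexing drops the previous value.\<close>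
  moreover have "recursive (\<lambda>z. P (psnd (psnd z)) (pfst z))"
    using recursive_compose[OF assms(2), of "\<lambda>z. pair (pfst z) (psnd (psnd z))"]
    by (simp add: computable)
  then have "computable (\<lambda>x. rec_nat 0 (\<lambda>k r. if P x k then 1 else r) (b x))"
    by (intro computable_rec computable computable_if assms(1))
  ultimately show ?thesis by (simp add: recursive_def)
qed

lemma recursive_ball [computable]:
  assumes "computable b" "recursive (\<lambda>z. P (psnd z) (pfst z))"
  shows "recursive (\<lambda>x. \<forall>y<b x. P x y)"
proof -
  have "recursive (\<lambda>x. \<not> (\<exists>y<b x. \<not> P x y))" by (intro computable assms)
  then show ?thesis by simp
qed

lemma recursive_finite_ball:
  "finite I \<Longrightarrow> (\<And>i. i \<in> I \<Longrightarrow> recursive (P i)) \<Longrightarrow> recursive (\<lambda>x. \<forall>i\<in>I. P i x)"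
  by (induction I rule: finite_induct) (auto intro: computable)

lemma recursive_finite_member:
  assumes "finite S" "computable f"
  shows "recursive (\<lambda>x. f x \<in> S)"
proof -
  have "recursive (\<lambda>x. \<not> (\<forall>i\<in>S. \<not> f x = i))"
    using assms by (intro computable recursive_finite_ball)
  then show ?thesis by simp
qed

text \<open>The binary digit \<open>k\<close> of \<open>t\<close> is 1 iff \<open>t\<close> is an
  odd multiple of \<open>2 ^ k\<close> plus a remainder below \<open>2 ^ k\<close>. This form needs
  no division, and both witnesses are bounded.\<close>

lemma recursive_set_decode [computable]:
  assumes "computable f" "computable g"
  shows "recursive (\<lambda>x. f x \<in> set_decode (g x))"
proof -
  have *: "k \<in> set_decode t \<longleftrightarrow> (\<exists>q<Suc t. \<exists>r<2 ^ k. t = (2 * q + 1) * 2 ^ k + r)" for k t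
  proof
    assume "k \<in> set_decode t"
    then have odd: "odd (t div 2 ^ k)" by (simp add: set_decode_def)
    then obtain q where q: "t div 2 ^ k = 2 * q + 1" by (auto elim: oddE)
    have "t = (2 * q + 1) * 2 ^ k + t mod 2 ^ k"
      using div_mult_mod_eq[of t "2 ^ k"] by (simp add: q)
    moreover have "q \<le> t" using q div_le_dividend[of t "2 ^ k"] by linarith
    ultimately show "\<exists>q<Suc t. \<exists>r<2 ^ k. t = (2 * q + 1) * 2 ^ k + r"
      by (intro exI[of _ q] conjI exI[of _ "t mod 2 ^ k"]) auto
  next
    assume "\<exists>q<Suc t. \<exists>r<2 ^ k. t = (2 * q + 1) * 2 ^ k + r"
    then obtain q r where "r < 2 ^ k" "t = (2 * q + 1) * 2 ^ k + r" by blast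
    then have "t div 2 ^ k = 2 * q + 1" by (metis div_mult_self3 div_less add.right_neutral power_not_zero zero_neq_numeral)
    then show "k \<in> set_decode t" by (simp add: set_decode_def)
  qed
  show ?thesis
    unfolding *
    by (intro computable computable_compose[OF assms(1)] computable_compose[OF assms(2)] assms)
qed

text \<open>\<open>0\<close> encodes the empty list and the tail of the list encoded by \<open>n > 0\<close> is encoded by \<open>psnd (n - 1)\<close>.\<close>
lemma recursive_list_member [computable]:
  assumes "computable f" "computable g"
  shows "recursive (\<lambda>x. f x \<in> set (list_decode (g x)))"
proof -
  \<comment> \<open>\<open>tails n i\<close> is the code of what is left after removing
    \<open>i\<close> entries. Truncated subtraction keeps the code 0 of the empty list fixed,
    because \<open>psnd 0 = 0\<close>.\<close>
  define tails where "tails n i = rec_nat n (\<lambda>_ t. psnd (t - 1)) i" for n i :: nat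
  have tails_Suc: "tails (Suc m) (Suc i) = tails (psnd m) i" for m i
    by (induction i) (auto simp: tails_def)
  have *: "y \<in> set (list_decode n) \<longleftrightarrow> (\<exists>i<n. tails n i > 0 \<and> pfst (tails n i - 1) = y)" for y n
  proof (induction n rule: less_induct)
    case (less n)
    show ?case
    proof (cases n)
      case 0
      then show ?thesis by simp
    next
      case (Suc m)
      have psnd: "psnd m < n" using psnd_le[of m] Suc by simp
      \<comment> \<open>Every removal lowers a positive code, so after \<open>k\<close> removals the
        code \<open>k\<close> is exhausted; a search through the positions below the code misses no
        entry.\<close>
      have zero: "tails k i = 0" if "k \<le> i" for k i
        using that
      proof (induction k arbitrary: i rule: less_induct)
        case (less k)
        show ?case
        proof (cases k)
          case 0
          have "psnd 0 = 0" using psnd_le[of 0] by simp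
          then show ?thesis unfolding 0 by (induction i) (auto simp: tails_def)
        next
          case (Suc l)
          then obtain j where j: "i = Suc j" using less.prems by (cases i) auto
          have "psnd l \<le> j" using psnd_le[of l] less.prems Suc j by simp
          then show ?thesis using less.IH[of "psnd l" j] psnd_le[of l] Suc j tails_Suc by simp
        qed
      qed
      have "y \<in> set (list_decode n) \<longleftrightarrow> y = pfst m \<or> y \<in> set (list_decode (psnd m))"
        unfolding Suc by (cases "prod_decode m") (simp add: pfst_def psnd_def)
      also have "\<dots> \<longleftrightarrow> y = pfst m \<or> (\<exists>i<psnd m. tails (psnd m) i > 0 \<and> pfst (tails (psnd m) i - 1) = y)"
        using less[OF psnd] by simp
      also have "\<dots> \<longleftrightarrow> y = pfst m \<or> (\<exists>i<m. tails (psnd m) i > 0 \<and> pfst (tails (psnd m) i - 1) = y)"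
        using zero[of "psnd m"] psnd_le[of m] by (metis le_less_trans less_le_trans not_less less_irrefl)
      also have "\<dots> \<longleftrightarrow> (\<exists>i<n. tails n i > 0 \<and> pfst (tails n i - 1) = y)"
      proof -
        have "tails n 0 = Suc m" by (simp add: tails_def Suc)
        then show ?thesis unfolding Suc Ex_less_Suc2 by (auto simp: tails_Suc)
      qed
      finally show ?thesis .
    qed
  qed
  have "computable (\<lambda>z. tails (g (psnd z)) (pfst z))"
    unfolding tails_def by (intro computable_rec computable computable_compose[OF assms(2)])
  then show ?thesis
    unfolding * by (intro computable computable_compose[OF assms(1)] assms)
qed

section \<open>Context-free grammars and rational transductions\<close>

text \<open>Big-step derivability of a terminal word. Unlike sequences of \<open>derives1\<close>,
  it splits along the symbols of a sentential form and gives structural induction over parse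
  trees.\<close>

inductive gen :: "('n, 't) prods \<Rightarrow> ('n, 't) sym list \<Rightarrow> 't list \<Rightarrow> bool" for P where
  Nil: "gen P [] []"
| Tm: "gen P ss w \<Longrightarrow> gen P (Tm a # ss) (a # w)"
| Nt: "(X, \<beta>) \<in> P \<Longrightarrow> gen P \<beta> u \<Longrightarrow> gen P ss v \<Longrightarrow> gen P (Nt X # ss) (u @ v)"

inductive_simps gen_Nil [simp]: "gen P [] w"
inductive_simps gen_Tm [simp]: "gen P (Tm a # ss) w"
inductive_simps gen_Nt: "gen P (Nt X # ss) w"

lemma gen_append: "gen P xs u \<Longrightarrow> gen P ys v \<Longrightarrow> gen P (xs @ ys) (u @ v)"
proof (induction rule: gen.induct)
  case (Nt X \<beta> s ss t)
  then show ?case using gen.Nt[of X \<beta> P s "ss @ ys" "t @ v"] by simp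
qed auto

lemma gen_append_iff: "gen P (xs @ ys) w \<longleftrightarrow> (\<exists>u v. w = u @ v \<and> gen P xs u \<and> gen P ys v)"
proof
  show "gen P (xs @ ys) w \<Longrightarrow> \<exists>u v. w = u @ v \<and> gen P xs u \<and> gen P ys v"
  proof (induction xs arbitrary: w)
    case Nil
    then show ?case by auto
  next
    case (Cons X xs)
    show ?case
    proof (cases X)
      case (Tm a)
      with Cons obtain w' where w': "w = a # w'" "gen P (xs @ ys) w'" by auto
      from Cons.IH[OF w'(2)] obtain u v where "w' = u @ v" "gen P xs u" "gen P ys v" by blast
      then show ?thesis using Tm w'(1) by (intro exI[of _ "a # u"] exI[of _ v]) auto
    next
      case (Nt N)
      with Cons.prems obtain \<beta> s w' where w': "w = s @ w'" "(N, \<beta>) \<in> P" "gen P \<beta> s" "gen P (xs @ ys) w'"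
        by (auto simp: gen_Nt)
      from Cons.IH[OF w'(4)] obtain u v where "w' = u @ v" "gen P xs u" "gen P ys v" by blast
      then show ?thesis using Nt w' by (intro exI[of _ "s @ u"] exI[of _ v]) (auto intro: gen.Nt)
    qed
  qed
qed (auto intro: gen_append)

lemma gen_map_Tm [simp]: "gen P (map Tm w) u \<longleftrightarrow> u = w"
  by (induction w arbitrary: u) auto

lemma gen_single: "gen P [Nt X] w \<longleftrightarrow> (\<exists>\<beta>. (X, \<beta>) \<in> P \<and> gen P \<beta> w)"
  by (auto simp: gen_Nt)

lemma derives1_context: "derives1 P s t \<Longrightarrow> derives1 P (x @ s @ y) (x @ t @ y)"
proof (induction rule: derives1.induct)
  case (1 X \<beta> u v)
  then show ?case using derives1.intros[of X \<beta> P "x @ u" "v @ y"] by simp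
qed

lemma derives_context: "(derives1 P)\<^sup>*\<^sup>* s t \<Longrightarrow> (derives1 P)\<^sup>*\<^sup>* (x @ s @ y) (x @ t @ y)"
  by (induction rule: rtranclp_induct) (auto intro: rtranclp.rtrancl_into_rtrancl derives1_context)

lemma cfg_lang_gen: "cfg_lang P S = {w. gen P [Nt S] w}"
proof -
  have "gen P ss w" if "(derives1 P)\<^sup>*\<^sup>* ss (map Tm w)" for ss w
    using that
  proof (induction rule: converse_rtranclp_induct)
    case (step s t)
    from step.hyps(1) obtain X \<beta> x y where X: "(X, \<beta>) \<in> P" "s = x @ [Nt X] @ y" "t = x @ \<beta> @ y"
      by (auto elim: derives1.cases)
    from step.IH obtain u v1 v2 where w: "w = u @ v1 @ v2" "gen P x u" "gen P \<beta> v1" "gen P y v2"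
      unfolding X gen_append_iff by blast
    show ?case
      unfolding X w using gen_append[OF w(2) gen.Nt[OF X(1) w(3,4)]] by simp
  qed simp
  moreover have "(derives1 P)\<^sup>*\<^sup>* ss (map Tm w)" if "gen P ss w" for ss w
    using that
  proof induction
    case (Tm ss w a)
    then show ?case using derives_context[of P ss "map Tm w" "[Tm a]" "[]"] by simp
  next
    case (Nt X \<beta> u ss v)
    have "derives1 P (Nt X # ss) (\<beta> @ ss)"
      using derives1.intros[OF Nt.hyps(1), of "[]" ss] by simp
    also have "(derives1 P)\<^sup>*\<^sup>* (\<beta> @ ss) (map Tm u @ ss)"
      using derives_context[OF Nt.IH(1), of "[]" ss] by simp
    also have "(derives1 P)\<^sup>*\<^sup>* (map Tm u @ ss) (map Tm u @ map Tm v)"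
      using derives_context[OF Nt.IH(2), of "map Tm u" "[]"] by simp
    finally show ?case by simp
  qed simp
  ultimately show ?thesis unfolding cfg_lang_def by blast
qed

text \<open>The language of a sentential form when each nonterminal \<open>X\<close> stands for the
  language \<open>I X\<close>. Making the words of \<open>I X\<close> right-hand sides of an
  auxiliary, possibly infinite grammar lets the facts on \<open>gen\<close> be reused.\<close>

definition interp :: "('n \<Rightarrow> 't list set) \<Rightarrow> ('n, 't) sym list \<Rightarrow> 't list set" where
  "interp I ss = {w. gen {(X, map Tm u) | X u. u \<in> I X} ss w}"

lemma interp_Nil [simp]: "interp I [] = {[]}"
  by (simp add: interp_def)

lemma in_interp_Tm [simp]: "w \<in> interp I (Tm a # ss) \<longleftrightarrow> (\<exists>u. w = a # u \<and> u \<in> interp I ss)"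
  by (auto simp: interp_def)

lemma in_interp_Nt [simp]:
  "w \<in> interp I (Nt X # ss) \<longleftrightarrow> (\<exists>u v. w = u @ v \<and> u \<in> I X \<and> v \<in> interp I ss)"
  unfolding interp_def gen_Nt mem_Collect_eq by fastforce

lemma in_interp_append:
  "w \<in> interp I (xs @ ys) \<longleftrightarrow> (\<exists>u v. w = u @ v \<and> u \<in> interp I xs \<and> v \<in> interp I ys)"
  by (simp add: interp_def gen_append_iff)

lemma interp_map_Tm [simp]: "interp I (map Tm w) = {w}"
  by (simp add: interp_def)

text \<open>The languages of the nonterminals are the least assignment closed under the productions,
  so exhibiting any closed \<open>I\<close> bounds them from above. The soundness of both grammar
  constructions below rests on this.\<close>

lemma gen_least:
  assumes "gen P ss w" "\<And>X \<beta>. (X, \<beta>) \<in> P \<Longrightarrow> interp I \<beta> \<subseteq> I X"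
  shows "w \<in> interp I ss"
  using assms(1)
proof induction
  case (Nt X \<beta> u ss v)
  then have "u \<in> I X" using assms(2) by blast
  with Nt.IH(2) show ?case unfolding in_interp_Nt by blast
qed auto

definition rename_prods :: "('n \<Rightarrow> 'm) \<Rightarrow> ('n, 't) prods \<Rightarrow> ('m, 't) prods" where
  "rename_prods f P = (\<lambda>(X, \<beta>). (f X, map (map_sym f id) \<beta>)) ` P"

lemma gen_rename: "gen P ss w \<Longrightarrow> gen (rename_prods f P) (map (map_sym f id) ss) w"
proof (induction rule: gen.induct)
  case (Nt X \<beta> u ss v)
  then have "(f X, map (map_sym f id) \<beta>) \<in> rename_prods f P" by (force simp: rename_prods_def)
  from gen.Nt[OF this Nt.IH] show ?case by simp
qed auto

text \<open>The finitely many nonterminals are numbered injectively by \<open>f\<close>. Renaming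
  back with an inverse \<open>g\<close> restores the grammar, so that \<open>gen_rename\<close>
  carries derivations in both directions.\<close>

lemma context_freeI:
  fixes P :: "('n, 't) prods"
  assumes "finite P"
  shows "context_free (cfg_lang P S)"
proof -
  define N where "N = insert S (\<Union>(X, \<beta>)\<in>P. insert X (\<Union>(set1_sym ` set \<beta>)))"
  have "finite (set1_sym s)" for s :: "('n, 't) sym" by (cases s) auto
  then have "finite N" using assms by (auto simp: N_def)
  then obtain f :: "'n \<Rightarrow> nat" where f: "inj_on f N" using finite_imp_inj_to_nat_seg by blast
  define g where "g = inv_into N f"
  have g: "g (f X) = X" if "X \<in> N" for X using that f by (simp add: g_def)
  have N: "X \<in> N" if "(X, \<beta>) \<in> P" for X \<beta> using that by (force simp: N_def)
  have sym: "map (map_sym g id \<circ> map_sym f id) \<beta> = \<beta>" if "(X, \<beta>) \<in> P" for X \<beta>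
  proof (rule map_idI)
    fix s assume "s \<in> set \<beta>"
    then have "set1_sym s \<subseteq> N" using that by (auto simp: N_def)
    then show "(map_sym g id \<circ> map_sym f id) s = s" using g by (cases s) auto
  qed
  have "(\<lambda>(X, \<beta>). (g (f X), map (map_sym g id \<circ> map_sym f id) \<beta>)) ` P = (\<lambda>x. x) ` P"
    by (rule image_cong) (use sym g N in auto)
  then have inv: "rename_prods g (rename_prods f P) = P"
    by (simp add: rename_prods_def image_image case_prod_unfold)
  have "S \<in> N" by (simp add: N_def)
  then have "cfg_lang (rename_prods f P) (f S) = cfg_lang P S"
    using gen_rename[of P "[Nt S]" _ f] gen_rename[of "rename_prods f P" "[Nt (f S)]" _ g]
    by (auto simp: cfg_lang_gen inv g)
  moreover have "finite (rename_prods f P)" using assms by (simp add: rename_prods_def)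
  ultimately show ?thesis by (auto simp: context_free_def)
qed

section \<open>Rational transductions of context-free languages\<close>

inductive transduces :: "('s \<times> 't option \<times> 'u list \<times> 's) set \<Rightarrow> 's \<Rightarrow> 't list \<Rightarrow> 'u list \<Rightarrow> 's \<Rightarrow> bool"
  for \<Delta> where
  refl: "transduces \<Delta> s [] [] s"
| eps: "(s, None, x, s') \<in> \<Delta> \<Longrightarrow> transduces \<Delta> s' z y t \<Longrightarrow> transduces \<Delta> s z (x @ y) t"
| read: "(s, Some a, x, s') \<in> \<Delta> \<Longrightarrow> transduces \<Delta> s' z y t \<Longrightarrow> transduces \<Delta> s (a # z) (x @ y) t"

lemma transduces_append:
  "transduces \<Delta> s z x r \<Longrightarrow> transduces \<Delta> r z' y t \<Longrightarrow> transduces \<Delta> s (z @ z') (x @ y) t"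
  by (induction rule: transduces.induct) (auto intro: transduces.intros)

lemma transduces_ConsD:
  assumes "transduces \<Delta> s (a # z) x t"
  obtains x1 r x2 r' x3 where "x = x1 @ x2 @ x3" "transduces \<Delta> s [] x1 r" "(r, Some a, x2, r') \<in> \<Delta>"
    "transduces \<Delta> r' z x3 t"
  using assms
proof (induction s "a # z" x t arbitrary: thesis rule: transduces.induct)
  case (eps s x s' y t)
  from eps.hyps(3) obtain x1 r x2 r' x3 where *: "y = x1 @ x2 @ x3" "transduces \<Delta> s' [] x1 r"
    "(r, Some a, x2, r') \<in> \<Delta>" "transduces \<Delta> r' z x3 t" by blast
  show ?case
    by (rule eps.prems[of "x @ x1" x2 x3 r r']) (use * eps.hyps in \<open>auto intro: transduces.eps\<close>)
next
  case (read s x s' y t)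
  then show ?case by (metis append_Nil transduces.refl)
qed

lemma transduces_appendD:
  assumes "transduces \<Delta> s (u @ v) x t"
  obtains x1 r x2 where "x = x1 @ x2" "transduces \<Delta> s u x1 r" "transduces \<Delta> r v x2 t"
  using assms
proof (induction u arbitrary: s x thesis)
  case Nil
  then show ?case by (metis append_Nil transduces.refl)
next
  case (Cons a u)
  from Cons.prems(2) obtain x1 r x2 r' x3 where *: "x = x1 @ x2 @ x3" "transduces \<Delta> s [] x1 r"
    "(r, Some a, x2, r') \<in> \<Delta>" "transduces \<Delta> r' (u @ v) x3 t" by (auto elim: transduces_ConsD)
  from Cons.IH[OF _ *(4)] obtain y1 q y2 where **: "x3 = y1 @ y2" "transduces \<Delta> r' u y1 q"
    "transduces \<Delta> q v y2 t" by blast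
  have "transduces \<Delta> s ([] @ a # u) (x1 @ x2 @ y1) q"
    by (rule transduces_append[OF *(2)]) (use * ** in \<open>auto intro: transduces.read\<close>)
  then show ?case using Cons.prems(1)[of "x1 @ x2 @ y1" y2 q] * ** by simp
qed

text \<open>The nonterminal \<open>(s, Y, t)\<close> generates the outputs along the runs from \<open>s\<close> to \<open>t\<close> whose input
  is generated by \<open>Y\<close>, or empty if \<open>Y\<close> is \<^term>\<open>None\<close>.\<close>

fun run_nts :: "'s set \<Rightarrow> 's \<Rightarrow> ('n, 't) sym list \<Rightarrow> 's \<Rightarrow> ('s \<times> ('n, 't) sym option \<times> 's) list set" where
  "run_nts Q s [] t = {[(s, None, t)]}"
| "run_nts Q s (Y # ss) t = (\<Union>r\<in>Q. (#) (s, Some Y, r) ` run_nts Q r ss t)"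

lemma finite_run_nts: "finite Q \<Longrightarrow> finite (run_nts Q s ss t)"
  by (induction Q s ss t rule: run_nts.induct) auto

text \<open>The triple construction for intersections with regular languages, extended by outputs.
  The first two families cover runs on the empty input and on one letter, the latter as a reading
  move between silent runs; the third guesses the states between the symbols of a right-hand
  side.\<close>

definition transduced_prods :: "('s \<times> 't option \<times> 'u list \<times> 's) set \<Rightarrow> 's set \<Rightarrow> ('n, 't) prods \<Rightarrow>
    ('s \<times> ('n, 't) sym option \<times> 's, 'u) prods" where
  "transduced_prods \<Delta> Q P =
     (\<Union>s\<in>Q. {((s, None, s), [])}) \<union>
     (\<Union>(s, i, x, r)\<in>\<Delta>. \<Union>t\<in>Q. case i of
         None \<Rightarrow> {((s, None, t), map Tm x @ [Nt (r, None, t)])}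
       | Some a \<Rightarrow> \<Union>q\<in>Q. {((q, Some (Tm a), t), Nt (q, None, s) # map Tm x @ [Nt (r, None, t)])}) \<union>
     (\<Union>(X, \<beta>)\<in>P. \<Union>s\<in>Q. \<Union>t\<in>Q. \<Union>ns\<in>run_nts Q s \<beta> t. {((s, Some (Nt X), t), map Nt ns)})"

lemma finite_transduced_prods:
  "finite \<Delta> \<Longrightarrow> finite Q \<Longrightarrow> finite P \<Longrightarrow> finite (transduced_prods \<Delta> Q P)"
  unfolding transduced_prods_def
  by (intro finite_UnI finite_UN_I) (auto simp: finite_run_nts split: option.split)

lemma gen_transduced_sound:
  assumes "gen (transduced_prods \<Delta> Q P) [Nt (s, Y, t)] x"
  shows "\<exists>z. gen P (case Y of None \<Rightarrow> [] | Some Z \<Rightarrow> [Z]) z \<and> transduces \<Delta> s z x t"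
proof -
  \<comment> \<open>\<open>I\<close> is the intended meaning of each triple; soundness is its
    closure under the productions.\<close>
  define I where "I = (\<lambda>(s, Y, t). {x. \<exists>z. gen P (case Y of None \<Rightarrow> [] | Some Z \<Rightarrow> [Z]) z \<and>
    transduces \<Delta> s z x t})"
  have run: "\<exists>z. gen P ss z \<and> transduces \<Delta> s z x t"
    if "ns \<in> run_nts Q s ss t" "x \<in> interp I (map Nt ns)" for ns s ss t x
    using that
  proof (induction ss arbitrary: s x ns)
    case Nil
    then show ?case by (auto simp: I_def)
  next
    case (Cons Y ss)
    from Cons.prems(1) obtain r ms where ms: "ns = (s, Some Y, r) # ms" "ms \<in> run_nts Q r ss t" by auto
    with Cons.prems(2) obtain u v where uv: "x = u @ v" "u \<in> I (s, Some Y, r)" "v \<in> interp I (map Nt ms)"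
      by auto
    from Cons.IH[OF ms(2) uv(3)] obtain z' where z': "gen P ss z'" "transduces \<Delta> r z' v t" by blast
    from uv(2) obtain z where z: "gen P [Y] z" "transduces \<Delta> s z u r" by (auto simp: I_def)
    show ?case
      using gen_append[OF z(1) z'(1)] transduces_append[OF z(2) z'(2)] uv(1) by auto
  qed
  have "x \<in> interp I [Nt (s, Y, t)]"
  proof (rule gen_least[OF assms])
    fix X \<beta> assume "(X, \<beta>) \<in> transduced_prods \<Delta> Q P"
    then show "interp I \<beta> \<subseteq> I X"
      unfolding transduced_prods_def
    proof (elim UnE)
      assume "(X, \<beta>) \<in> (\<Union>s\<in>Q. {((s, None, s), [])})"
      then show ?thesis by (auto simp: I_def intro: transduces.refl)
    next
      assume "(X, \<beta>) \<in> (\<Union>(s, i, x, r)\<in>\<Delta>. \<Union>t\<in>Q. case i of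
         None \<Rightarrow> {((s, None, t), map Tm x @ [Nt (r, None, t)])}
       | Some a \<Rightarrow> \<Union>q\<in>Q. {((q, Some (Tm a), t), Nt (q, None, s) # map Tm x @ [Nt (r, None, t)])})"
      then obtain s i x r t where \<Delta>: "(s, i, x, r) \<in> \<Delta>" and
        "(X, \<beta>) \<in> (case i of None \<Rightarrow> {((s, None, t), map Tm x @ [Nt (r, None, t)])}
          | Some a \<Rightarrow> \<Union>q\<in>Q. {((q, Some (Tm a), t), Nt (q, None, s) # map Tm x @ [Nt (r, None, t)])})"
        by auto
      then consider
          "i = None" "X = (s, None, t)" "\<beta> = map Tm x @ [Nt (r, None, t)]"
        | a q where "i = Some a" "X = (q, Some (Tm a), t)" "\<beta> = Nt (q, None, s) # map Tm x @ [Nt (r, None, t)]"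
        by (auto split: option.splits)
      then show ?thesis
      proof cases
        case 1
        then show ?thesis using \<Delta> by (auto simp: I_def in_interp_append intro: transduces.eps)
      next
        case 2
        have "transduces \<Delta> q [a] (u @ x @ v) t"
          if "transduces \<Delta> q [] u s" "transduces \<Delta> r [] v t" for u v
          using transduces_append[OF that(1) transduces.read[OF \<Delta>[unfolded 2] that(2)]] by simp
        then show ?thesis using 2 by (auto simp: I_def in_interp_append)
      qed
    next
      assume "(X, \<beta>) \<in> (\<Union>(X, \<beta>)\<in>P. \<Union>s\<in>Q. \<Union>t\<in>Q. \<Union>ns\<in>run_nts Q s \<beta> t. {((s, Some (Nt X), t), map Nt ns)})"
      then obtain N \<gamma> s t ns where *: "(N, \<gamma>) \<in> P" "ns \<in> run_nts Q s \<gamma> t"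
        "X = (s, Some (Nt N), t)" "\<beta> = map Nt ns" by auto
      show ?thesis
      proof
        fix x assume "x \<in> interp I \<beta>"
        with run[OF *(2)] *(4) obtain z where "gen P \<gamma> z" "transduces \<Delta> s z x t" by blast
        with *(1) show "x \<in> I X" unfolding *(3) I_def by (auto simp: gen_single)
      qed
    qed
  qed
  then show ?thesis by (auto simp: I_def)
qed

lemma gen_transduced_complete:
  fixes \<Delta> :: "('s \<times> 't option \<times> 'u list \<times> 's) set"
  assumes Q: "\<And>s i x r. (s, i, x, r) \<in> \<Delta> \<Longrightarrow> s \<in> Q \<and> r \<in> Q"
    and "gen P ss z" "transduces \<Delta> s z x t" "s \<in> Q" "t \<in> Q"
  shows "\<exists>ns\<in>run_nts Q s ss t. gen (transduced_prods \<Delta> Q P) (map Nt ns) x"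
proof -
  let ?G = "transduced_prods \<Delta> Q P"
  have in_Q: "r \<in> Q" if "transduces \<Delta> r z x q" "q \<in> Q" for r z x q
    using that by induction (auto dest: Q)
  have in_Q': "q \<in> Q" if "transduces \<Delta> r z x q" "r \<in> Q" for r z x q
    using that by induction (auto dest: Q)
  have eps: "gen ?G [Nt (r, None, q)] y" if "transduces \<Delta> r [] y q" "q \<in> Q" for r q y
    using that
  proof (induction r "[] :: 't list" y q rule: transduces.induct)
    case (refl s)
    then have "((s, None, s), []) \<in> ?G" by (auto simp: transduced_prods_def)
    then show ?case by (auto simp: gen_single)
  next
    case (eps s x s' y t)
    then have "((s, None, t), map Tm x @ [Nt (s', None, t)]) \<in> ?G"
      by (force simp: transduced_prods_def)
    then show ?case using eps by (subst gen_single) (auto simp: gen_append_iff)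
  qed
  show ?thesis
    using assms(2-)
  proof (induction arbitrary: s t x)
    case Nil
    then show ?case using eps by auto
  next
    case (Tm ss z a)
    from Tm.prems(1) obtain x1 r x2 r' x3 where *: "x = x1 @ x2 @ x3" "transduces \<Delta> s [] x1 r"
      "(r, Some a, x2, r') \<in> \<Delta>" "transduces \<Delta> r' z x3 t" by (rule transduces_ConsD)
    have r: "r \<in> Q" "r' \<in> Q" using Q[OF *(3)] by auto
    from Tm.IH[OF *(4) r(2) Tm.prems(3)] obtain ns where ns: "ns \<in> run_nts Q r' ss t" "gen ?G (map Nt ns) x3"
      by blast
    \<comment> \<open>The letter takes the silent moves before it; those after it are left to the
      following symbols, so the last triple is the empty run at \<open>r'\<close>.\<close>
    have "((s, Some (Tm a), r'), Nt (s, None, r) # map Tm x2 @ [Nt (r', None, r')]) \<in> ?G"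
      using *(3) r Tm.prems(2) by (force simp: transduced_prods_def)
    moreover have "gen ?G ([Nt (s, None, r)] @ map Tm x2 @ [Nt (r', None, r')]) (x1 @ x2 @ [])"
      using eps[OF *(2) r(1)] eps[OF transduces.refl r(2)] by (intro gen_append) auto
    ultimately have "gen ?G [Nt (s, Some (Tm a), r')] (x1 @ x2)" by (auto simp: gen_single)
    from gen_append[OF this ns(2)] show ?case
      using ns(1) r(2) *(1) by (intro bexI[of _ "(s, Some (Tm a), r') # ns"]) auto
  next
    case (Nt X \<beta> u ss v)
    from Nt.prems(1) obtain x1 r x2 where *: "x = x1 @ x2" "transduces \<Delta> s u x1 r" "transduces \<Delta> r v x2 t"
      by (rule transduces_appendD)
    have r: "r \<in> Q" using in_Q[OF *(3) Nt.prems(3)] .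
    from Nt.IH(1)[OF *(2) Nt.prems(2) r] obtain ms where
      ms: "ms \<in> run_nts Q s \<beta> r" "gen ?G (map Nt ms) x1" by blast
    from Nt.IH(2)[OF *(3) r Nt.prems(3)] obtain ns where
      ns: "ns \<in> run_nts Q r ss t" "gen ?G (map Nt ns) x2" by blast
    have "((s, Some (Nt X), r), map Nt ms) \<in> ?G"
      using ms(1) Nt.hyps(1) Nt.prems(2) r by (fastforce simp: transduced_prods_def)
    then have "gen ?G [Nt (s, Some (Nt X), r)] x1" using ms(2) by (auto simp: gen_single)
    from gen_append[OF this ns(2)] show ?case
      using ns(1) r *(1) by (intro bexI[of _ "(s, Some (Nt X), r) # ns"]) auto
  qed
qed

theorem context_free_transduction:
  assumes "context_free L" "finite \<Delta>"
  shows "context_free {x. \<exists>z\<in>L. transduces \<Delta> s z x t}"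
proof -
  from assms(1) obtain P :: "(nat, _) prods" and S where P: "finite P" "L = cfg_lang P S"
    by (auto simp: context_free_def)
  \<comment> \<open>\<open>s\<close> and \<open>t\<close> must be present even if no move of
    \<open>\<Delta>\<close> involves them.\<close>
  define Q where "Q = {s, t} \<union> (\<Union>(r, i, x, q)\<in>\<Delta>. {r, q})"
  have "finite Q" using assms(2) by (auto simp: Q_def)
  have "cfg_lang (transduced_prods \<Delta> Q P) (s, Some (Nt S), t) = {x. \<exists>z\<in>L. transduces \<Delta> s z x t}"
  proof (intro Set.set_eqI iffI)
    fix x assume "x \<in> cfg_lang (transduced_prods \<Delta> Q P) (s, Some (Nt S), t)"
    then show "x \<in> {x. \<exists>z\<in>L. transduces \<Delta> s z x t}"
      using gen_transduced_sound[of \<Delta> Q P s "Some (Nt S)" t x] by (auto simp: cfg_lang_gen P(2))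
  next
    fix x assume "x \<in> {x. \<exists>z\<in>L. transduces \<Delta> s z x t}"
    then obtain z where z: "gen P [Nt S] z" "transduces \<Delta> s z x t" by (auto simp: cfg_lang_gen P(2))
    \<comment> \<open>The first production is unfolded by hand: applied to \<open>[Nt S]\<close>,
      the completeness lemma would yield a further triple \<open>(r, None, t)\<close> after the
      start symbol.\<close>
    from z(1) obtain \<beta> where \<beta>: "(S, \<beta>) \<in> P" "gen P \<beta> z" by (auto simp: gen_single)
    have "\<exists>ns\<in>run_nts Q s \<beta> t. gen (transduced_prods \<Delta> Q P) (map Nt ns) x"
      by (rule gen_transduced_complete[OF _ \<beta>(2) z(2)]) (force simp: Q_def)+
    then obtain ns where ns: "ns \<in> run_nts Q s \<beta> t" "gen (transduced_prods \<Delta> Q P) (map Nt ns) x" by blast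
    have "((s, Some (Nt S), t), map Nt ns) \<in> transduced_prods \<Delta> Q P"
      using ns(1) \<beta>(1) by (fastforce simp: transduced_prods_def Q_def)
    then show "x \<in> cfg_lang (transduced_prods \<Delta> Q P) (s, Some (Nt S), t)"
      using ns(2) by (auto simp: cfg_lang_gen gen_single)
  qed
  then show ?thesis
    using context_freeI[OF finite_transduced_prods[OF assms(2) \<open>finite Q\<close> P(1)]] by metis
qed

section \<open>Sealed pairs and their nested grammar\<close>

inductive sealed_pairs :: "'a set \<Rightarrow> 'a list \<Rightarrow> ('a list \<times> 'a list) set \<Rightarrow> 'a list \<Rightarrow> 'a list \<Rightarrow> bool"
  for A \<alpha> K where
  Nil: "sealed_pairs A \<alpha> K [] []"
| letter: "a \<in> A \<Longrightarrow> sealed_pairs A \<alpha> K u v \<Longrightarrow> sealed_pairs A \<alpha> K (a # u) (a # v)"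
| seal: "(x, y) \<in> K \<Longrightarrow> sealed_pairs A \<alpha> K u v \<Longrightarrow> sealed_pairs A \<alpha> K (x @ \<alpha> @ u) (y @ \<alpha> @ v)"

definition pair_word :: "'a list \<Rightarrow> 'a list \<Rightarrow> 'a option list" where
  "pair_word u v = map Some u @ [None] @ rev (map Some v)"

lemma pair_word_inject [simp]: "pair_word u v = pair_word u' v' \<longleftrightarrow> u = u' \<and> v = v'"
proof -
  have "map Some u @ None # r = map Some u' @ None # r' \<longleftrightarrow> u = u' \<and> r = r'" for r r' :: "'a option list"
  proof (induction u arbitrary: u')
    case Nil
    then show ?case by (cases u') auto
  next
    case (Cons a u)
    then show ?case by (cases u') auto
  qed
  then show ?thesis by (auto simp: pair_word_def inj_map_eq_map)
qed

text \<open>This is a substitution for the separator. It allows any number of separators, as the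
  nonterminals of an arbitrary grammar may generate such words even if the start symbol does
  not.\<close>

inductive plug :: "('a option list \<Rightarrow> bool) \<Rightarrow> 'a list \<Rightarrow> 'a option list \<Rightarrow> 'a option list \<Rightarrow> bool"
  for W \<alpha> where
  Nil: "plug W \<alpha> [] []"
| Some: "plug W \<alpha> z w \<Longrightarrow> plug W \<alpha> (Some a # z) (Some a # w)"
| None: "W v \<Longrightarrow> plug W \<alpha> z w \<Longrightarrow> plug W \<alpha> (None # z) (map Some \<alpha> @ v @ map Some (rev \<alpha>) @ w)"

inductive_simps plug_Nil [simp]: "plug W \<alpha> [] w"
inductive_simps plug_Some [simp]: "plug W \<alpha> (Some a # z) w"
inductive_simps plug_None [simp]: "plug W \<alpha> (None # z) w"

lemma plug_map_Some [simp]: "plug W \<alpha> (map Some x) w \<longleftrightarrow> w = map Some x"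
  by (induction x arbitrary: w) auto

lemma plug_append: "plug W \<alpha> y u \<Longrightarrow> plug W \<alpha> z v \<Longrightarrow> plug W \<alpha> (y @ z) (u @ v)"
proof (induction rule: plug.induct)
  case (None s y u)
  from plug.None[of W, OF None.hyps(1) None.IH[OF None.prems]] show ?case by simp
qed auto

lemma plug_append_iff:
  "plug W \<alpha> (y @ z) w \<longleftrightarrow> (\<exists>u v. w = u @ v \<and> plug W \<alpha> y u \<and> plug W \<alpha> z v)"
proof
  show "plug W \<alpha> (y @ z) w \<Longrightarrow> \<exists>u v. w = u @ v \<and> plug W \<alpha> y u \<and> plug W \<alpha> z v"
  proof (induction y arbitrary: w)
    case (Cons a y)
    show ?case
    proof (cases a)
      case None
      with Cons.prems obtain s t where st: "w = map Some \<alpha> @ s @ map Some (rev \<alpha>) @ t" "W s"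
        "plug W \<alpha> (y @ z) t" by (auto simp del: map_map)
      from Cons.IH[OF st(3)] obtain u v where "t = u @ v" "plug W \<alpha> y u" "plug W \<alpha> z v" by blast
      then show ?thesis
        using plug.None[of W s \<alpha> y u] st(1,2) None
        by (intro exI[of _ "map Some \<alpha> @ s @ map Some (rev \<alpha>) @ u"] exI[of _ v]) simp
    next
      case (Some b)
      with Cons.prems obtain t where t: "w = Some b # t" "plug W \<alpha> (y @ z) t" by auto
      from Cons.IH[OF t(2)] obtain u v where "t = u @ v" "plug W \<alpha> y u" "plug W \<alpha> z v" by blast
      then show ?thesis using t(1) Some by (intro exI[of _ "Some b # u"] exI[of _ v]) simp
    qed
  qed auto
qed (auto intro: plug_append)

lemma plug_pair_word:
  "plug W \<alpha> (pair_word x y) w \<longleftrightarrow> (\<exists>v. w = map Some (x @ \<alpha>) @ v @ rev (map Some (y @ \<alpha>)) \<and> W v)"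
proof -
  have "plug W \<alpha> ([None] @ map Some (rev y)) v \<longleftrightarrow>
    (\<exists>u. v = map Some \<alpha> @ u @ map Some (rev \<alpha>) @ map Some (rev y) \<and> W u)" for v
    by auto
  then show ?thesis unfolding pair_word_def plug_append_iff rev_map by auto
qed

fun plug_sym :: "'a list \<Rightarrow> ('n, 'a option) sym \<Rightarrow> ('n option, 'a option) sym list" where
  "plug_sym \<alpha> (Nt X) = [Nt (Some X)]"
| "plug_sym \<alpha> (Tm (Some a)) = [Tm (Some a)]"
| "plug_sym \<alpha> (Tm None) = map Tm (map Some \<alpha>) @ [Nt None] @ map Tm (map Some (rev \<alpha>))"

text \<open>\<open>None\<close> is the new start symbol and \<open>Some X\<close> a copy of the old
  nonterminal \<open>X\<close>. Since \<open>plug_sym\<close> puts \<open>None\<close> in the place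
  of the old separator, the grammar is recursive through the middle of its own words.\<close>

definition sealed_prods :: "'a set \<Rightarrow> 'a list \<Rightarrow> ('n, 'a option) prods \<Rightarrow> 'n \<Rightarrow> ('n option, 'a option) prods" where
  "sealed_prods A \<alpha> P S =
     {(None, [Tm None]), (None, [Nt (Some S)])} \<union>
     (\<lambda>a. (None, [Tm (Some a), Nt None, Tm (Some a)])) ` A \<union>
     (\<lambda>(X, \<beta>). (Some X, concat (map (plug_sym \<alpha>) \<beta>))) ` P"

lemma gen_plug_complete:
  assumes "gen P ss z" "plug (gen (sealed_prods A \<alpha> P S) [Nt None]) \<alpha> z w"
  shows "gen (sealed_prods A \<alpha> P S) (concat (map (plug_sym \<alpha>) ss)) w"
  using assms
proof (induction arbitrary: w)
  case (Tm ss z a)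
  show ?case
  proof (cases a)
    case None
    with Tm.prems obtain v u where w: "w = map Some \<alpha> @ v @ map Some (rev \<alpha>) @ u"
      "gen (sealed_prods A \<alpha> P S) [Nt None] v" "plug (gen (sealed_prods A \<alpha> P S) [Nt None]) \<alpha> z u"
      by auto
    have "gen (sealed_prods A \<alpha> P S)
      (map Tm (map Some \<alpha>) @ [Nt None] @ map Tm (map Some (rev \<alpha>)) @ concat (map (plug_sym \<alpha>) ss)) w"
      unfolding w(1) by (intro gen_append w Tm.IH) (simp_all del: map_map)
    then show ?thesis using None by simp
  qed (use Tm in auto)
next
  case (Nt X \<beta> u ss v)
  from Nt.prems obtain x y where w: "w = x @ y"
    "plug (gen (sealed_prods A \<alpha> P S) [Nt None]) \<alpha> u x"
    "plug (gen (sealed_prods A \<alpha> P S) [Nt None]) \<alpha> v y" unfolding plug_append_iff by blast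
  have "(Some X, concat (map (plug_sym \<alpha>) \<beta>)) \<in> sealed_prods A \<alpha> P S"
    using Nt.hyps(1) by (force simp: sealed_prods_def)
  from gen.Nt[OF this Nt.IH(1)[OF w(2)] Nt.IH(2)[OF w(3)]] show ?case by (simp add: w(1))
qed simp

text \<open>Stated for \<open>interp\<close>, because \<open>gen_least\<close> supplies only assumed
  meanings of the nonterminals on a right-hand side.\<close>

lemma interp_plug_sound:
  assumes "w \<in> interp I (concat (map (plug_sym \<alpha>) ss))"
    and "\<And>X u. u \<in> I (Some X) \<Longrightarrow> \<exists>z. gen P [Nt X] z \<and> plug W \<alpha> z u"
    and "\<And>u. u \<in> I None \<Longrightarrow> W u"
  shows "\<exists>z. gen P ss z \<and> plug W \<alpha> z w"
  using assms(1)
proof (induction ss arbitrary: w)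
  case (Cons s ss)
  from Cons.prems obtain u v where w: "w = u @ v" "u \<in> interp I (plug_sym \<alpha> s)"
    "v \<in> interp I (concat (map (plug_sym \<alpha>) ss))"
    by (auto simp: in_interp_append)
  from Cons.IH[OF w(3)] obtain z where z: "gen P ss z" "plug W \<alpha> z v" by blast
  have "\<exists>y. gen P [s] y \<and> plug W \<alpha> y u"
  proof (cases s)
    case (Nt X)
    then show ?thesis using w(2) assms(2) by auto
  next
    case (Tm a)
    show ?thesis
    proof (cases a)
      case None
      then obtain v where "u = map Some \<alpha> @ v @ map Some (rev \<alpha>)" "v \<in> I None"
        using w(2) Tm by (auto simp: in_interp_append simp del: map_map)
      then show ?thesis using Tm None assms(3) by auto
    next
      case (Some b)
      then show ?thesis using w(2) Tm by (intro exI[of _ "[a]"]) auto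
    qed
  qed
  then obtain y where y: "gen P [s] y" "plug W \<alpha> y u" by blast
  have "plug W \<alpha> (y @ z) w" unfolding plug_append_iff using y z w(1) by blast
  then show ?case using gen_append[OF y(1) z(1)] by auto
qed simp

text \<open>Each rule of \<open>sealed_pairs\<close> extends both words at their left ends, which
  are the two outer ends of \<open>pair_word u v\<close>; derivations are thus nested around the
  separator.\<close>

lemma context_free_sealed:
  assumes "finite A" "context_free {pair_word x y | x y. (x, y) \<in> K}"
  shows "context_free {pair_word u v | u v. sealed_pairs A \<alpha> K u v}"
proof -
  from assms(2) obtain P :: "(nat, _) prods" and S where
    P: "finite P" "{pair_word x y | x y. (x, y) \<in> K} = cfg_lang P S"
    unfolding context_free_def by blast
  let ?G = "sealed_prods A \<alpha> P S" and ?W = "{pair_word u v | u v. sealed_pairs A \<alpha> K u v}"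
  have "gen ?G [Nt None] (pair_word u v)" if "sealed_pairs A \<alpha> K u v" for u v
    using that
  proof induction
    case Nil
    have "(None, [Tm None]) \<in> ?G" by (simp add: sealed_prods_def)
    then show ?case by (auto simp: gen_single pair_word_def)
  next
    case (letter a u v)
    have "(None, [Tm (Some a), Nt None, Tm (Some a)]) \<in> ?G"
      using letter.hyps by (auto simp: sealed_prods_def)
    moreover have "gen ?G ([Tm (Some a)] @ [Nt None] @ [Tm (Some a)]) ([Some a] @ pair_word u v @ [Some a])"
      by (intro gen_append letter.IH) auto
    ultimately show ?case by (auto simp: gen_single pair_word_def)
  next
    case (seal x y u v)
    have "pair_word x y \<in> cfg_lang P S" using seal.hyps(1) P(2) by blast
    then have "gen P [Nt S] (pair_word x y)" by (simp add: cfg_lang_gen)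
    moreover have "pair_word (x @ \<alpha> @ u) (y @ \<alpha> @ v) =
      map Some (x @ \<alpha>) @ pair_word u v @ rev (map Some (y @ \<alpha>))"
      by (simp add: pair_word_def)
    then have "plug (gen ?G [Nt None]) \<alpha> (pair_word x y) (pair_word (x @ \<alpha> @ u) (y @ \<alpha> @ v))"
      unfolding plug_pair_word using seal.IH by blast
    ultimately have "gen ?G (concat (map (plug_sym \<alpha>) [Nt S])) (pair_word (x @ \<alpha> @ u) (y @ \<alpha> @ v))"
      by (rule gen_plug_complete)
    then have "gen ?G [Nt (Some S)] (pair_word (x @ \<alpha> @ u) (y @ \<alpha> @ v))" by simp
    moreover have "(None, [Nt (Some S)]) \<in> ?G" by (simp add: sealed_prods_def)
    ultimately show ?case by (auto simp: gen_single[where X = None])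
  qed
  moreover have "w \<in> ?W" if "gen ?G [Nt None] w" for w
  proof -
    \<comment> \<open>The meanings of the start symbol and of the copied nonterminals refer to each
      other: the latter are the old languages with words of \<open>?W\<close> plugged in.\<close>
    define I where "I X = (case X of None \<Rightarrow> ?W
      | Some X \<Rightarrow> {w. \<exists>z. gen P [Nt X] z \<and> plug (\<lambda>v. v \<in> ?W) \<alpha> z w})" for X
    have "w \<in> interp I [Nt None]"
    proof (rule gen_least[OF that])
      fix X \<beta> assume "(X, \<beta>) \<in> ?G"
      then consider "X = None" "\<beta> = [Tm None]" | "X = None" "\<beta> = [Nt (Some S)]"
        | a where "a \<in> A" "X = None" "\<beta> = [Tm (Some a), Nt None, Tm (Some a)]"
        | N \<gamma> where "(N, \<gamma>) \<in> P" "X = Some N" "\<beta> = concat (map (plug_sym \<alpha>) \<gamma>)"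
        by (auto simp: sealed_prods_def)
      then show "interp I \<beta> \<subseteq> I X"
      proof cases
        case 1
        have "[None] = pair_word [] []" by (simp add: pair_word_def)
        then have "[None] \<in> ?W" using sealed_pairs.Nil by blast
        moreover have "interp I \<beta> = {[None]}" using interp_map_Tm[of I "[None]"] 1 by simp
        ultimately show ?thesis using 1 by (simp add: I_def)
      next
        case 2
        show ?thesis
        proof
          fix w assume "w \<in> interp I \<beta>"
          with 2 obtain z where z: "z \<in> cfg_lang P S" "plug (\<lambda>v. v \<in> ?W) \<alpha> z w"
            by (auto simp: I_def cfg_lang_gen)
          from z(1)[folded P(2)] obtain x y where xy: "(x, y) \<in> K" "z = pair_word x y" by blast
          from z(2)[unfolded xy(2) plug_pair_word] obtain u v where
            uv: "sealed_pairs A \<alpha> K u v" "w = map Some (x @ \<alpha>) @ pair_word u v @ rev (map Some (y @ \<alpha>))"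
            by blast
          have "w = pair_word (x @ \<alpha> @ u) (y @ \<alpha> @ v)" by (simp add: uv(2) pair_word_def)
          then show "w \<in> I X" using sealed_pairs.seal[OF xy(1) uv(1)] 2 by (auto simp: I_def)
        qed
      next
        case 3
        have "Some a # pair_word u v @ [Some a] = pair_word (a # u) (a # v)" for u v
          by (simp add: pair_word_def)
        with 3 show ?thesis using sealed_pairs.letter[OF 3(1)] by (auto simp: I_def)
      next
        case 4
        show ?thesis
        proof
          fix w assume "w \<in> interp I \<beta>"
          then have "\<exists>z. gen P \<gamma> z \<and> plug (\<lambda>v. v \<in> ?W) \<alpha> z w"
            unfolding 4(3) by (rule interp_plug_sound) (simp_all add: I_def)
          then show "w \<in> I X" using 4(1) unfolding I_def 4(2) by (auto simp: gen_single)
        qed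
      qed
    qed
    then show ?thesis by (simp add: I_def)
  qed
  ultimately have "cfg_lang ?G None = ?W" unfolding cfg_lang_gen by blast
  moreover have "finite ?G" using P(1) assms(1) by (simp add: sealed_prods_def)
  ultimately show ?thesis using context_freeI by metis
qed

section \<open>The word problem of a weakly compressible monoid\<close>

lemma pres_cong_in_lists:
  assumes "R \<subseteq> lists A \<times> lists A" "(u, v) \<in> pres_cong A R"
  shows "u \<in> lists A" "v \<in> lists A"
  using equiv_pres_cong[OF assms(1)] assms(2) by (auto simp: equiv_def)

lemma pres_cong_append2:
  assumes "R \<subseteq> lists A \<times> lists A" "(u, v) \<in> pres_cong A R" "(x, y) \<in> pres_cong A R"
  shows "(u @ x, v @ y) \<in> pres_cong A R"
  using pres_cong_append[OF assms(1,2), of "[]" x] pres_cong_append[OF assms(1,3), of v "[]"]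
    pres_cong_in_lists[OF assms(1,2)] pres_cong_in_lists[OF assms(1,3)]
  by (auto intro: pres_cong.trans)

lemma append_Cons_first_outside:
  assumes "set y \<subseteq> G" "set y' \<subseteq> G" "s \<notin> G" "s' \<notin> G" "y @ s # t = y' @ s' # t'"
  shows "y = y' \<and> s = s' \<and> t = t'"
  using assms
proof (induction y arbitrary: y')
  case Nil
  then show ?case by (cases y') auto
next
  case (Cons a y)
  then show ?case by (cases y') auto
qed

text \<open>The free product of the monoid presented by the relations over \<open>G\<close> with the free monoid on
  \<open>S - G\<close>, as a congruence.\<close>
inductive free_product_cong :: "'a set \<Rightarrow> 'a set \<Rightarrow> ('a list \<times> 'a list) set \<Rightarrow> 'a list \<Rightarrow> 'a list \<Rightarrow> bool"
  for S G C where
  base: "(x, y) \<in> C \<Longrightarrow> set x \<subseteq> G \<Longrightarrow> set y \<subseteq> G \<Longrightarrow> free_product_cong S G C x y"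
| step: "(x, y) \<in> C \<Longrightarrow> set x \<subseteq> G \<Longrightarrow> set y \<subseteq> G \<Longrightarrow> s \<in> S \<Longrightarrow> s \<notin> G \<Longrightarrow> free_product_cong S G C u v \<Longrightarrow>
    free_product_cong S G C (x @ s # u) (y @ s # v)"

text \<open>The middle word \<open>y\<close> splits at its first letter outside \<open>G\<close> in
  only one way, so the two chains of blocks match and transitivity applies blockwise.\<close>

lemma free_product_cong_trans:
  assumes "free_product_cong S G (pres_cong S R) x y" "free_product_cong S G (pres_cong S R) y z"
  shows "free_product_cong S G (pres_cong S R) x z"
  using assms
proof (induction arbitrary: z)
  case (base x y)
  from base.prems show ?case
  proof cases
    case base
    then show ?thesis using \<open>(x, y) \<in> _\<close> \<open>set x \<subseteq> G\<close>
      by (auto intro: free_product_cong.base pres_cong.trans)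
  qed (use base.hyps in auto)
next
  case (step x y s u v)
  from step.prems show ?case
  proof cases
    case base
    then show ?thesis using step.hyps by auto
  next
    case (step x' y' s' u' v')
    then have "y = x' \<and> s = s' \<and> v = u'" using \<open>set y \<subseteq> G\<close> \<open>s \<notin> G\<close>
      by (intro append_Cons_first_outside[of _ G]) auto
    then show ?thesis using step \<open>(x, y) \<in> _\<close> \<open>set x \<subseteq> G\<close> \<open>s \<in> S\<close> step.IH
      by (auto intro: free_product_cong.step pres_cong.trans)
  qed
qed

lemma free_product_cong_sym:
  "free_product_cong S G (pres_cong S R) x y \<Longrightarrow> free_product_cong S G (pres_cong S R) y x"
  by (induction rule: free_product_cong.induct) (auto intro: free_product_cong.intros pres_cong.sym)

lemma free_product_cong_append:
  assumes "R \<subseteq> lists S \<times> lists S" "(x, y) \<in> pres_cong S R" "set x \<subseteq> G" "set y \<subseteq> G"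
    "free_product_cong S G (pres_cong S R) u v"
  shows "free_product_cong S G (pres_cong S R) (x @ u) (y @ v)"
  using assms(5)
proof cases
  case base
  then show ?thesis
    using assms(3,4) pres_cong_append2[OF assms(1,2)] by (intro free_product_cong.base) auto
next
  case (step x' y' s u' v')
  have "free_product_cong S G (pres_cong S R) ((x @ x') @ s # u') ((y @ y') @ s # v')"
    by (rule free_product_cong.step) (use step assms(3,4) pres_cong_append2[OF assms(1,2)] in auto)
  then show ?thesis using step by simp
qed

text \<open>A prefixed letter of \<open>G\<close> joins the first block; any other letter separates
  a new, empty block from the rest.\<close>

lemma free_product_cong_prefix:
  assumes "R \<subseteq> lists S \<times> lists S" "G \<subseteq> S" "p \<in> lists S" "free_product_cong S G (pres_cong S R) u v"
  shows "free_product_cong S G (pres_cong S R) (p @ u) (p @ v)"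
  using assms(3)
proof (induction p)
  case Nil
  then show ?case using assms(4) by simp
next
  case (Cons s p)
  show ?case
  proof (cases "s \<in> G")
    case True
    have "([s], [s]) \<in> pres_cong S R" using Cons.hyps by (auto intro: pres_cong.refl)
    from free_product_cong_append[OF assms(1) this _ _ Cons.IH] True show ?thesis by simp
  next
    case False
    have "([], []) \<in> pres_cong S R" by (auto intro: pres_cong.refl)
    from free_product_cong.step[OF this _ _ _ False Cons.IH] Cons.hyps show ?thesis by simp
  qed
qed

lemma free_product_cong_refl:
  assumes "R \<subseteq> lists S \<times> lists S" "G \<subseteq> S" "p \<in> lists S"
  shows "free_product_cong S G (pres_cong S R) p p"
proof -
  have "free_product_cong S G (pres_cong S R) [] []"
    by (auto intro: free_product_cong.base pres_cong.refl)
  from free_product_cong_prefix[OF assms this] show ?thesis by simp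
qed

text \<open>Both sides of a relation are words over \<open>G\<close>, so it is applied inside one
  block and leaves the letters outside \<open>G\<close> alone.\<close>

lemma pres_cong_imp_free_product_cong:
  assumes "R \<subseteq> lists S \<times> lists S" "G \<subseteq> S" "R \<subseteq> lists G \<times> lists G" "(u, v) \<in> pres_cong S R"
  shows "free_product_cong S G (pres_cong S R) u v"
  using assms(4)
proof induction
  case (refl w)
  then show ?case by (rule free_product_cong_refl[OF assms(1,2)])
next
  case (rel u v p s)
  have "(u, v) \<in> pres_cong S R" using pres_cong.rel[OF rel(1), of "[]" S "[]"] by simp
  moreover have "set u \<subseteq> G" "set v \<subseteq> G" using rel(1) assms(3) by auto
  ultimately show ?case
    using free_product_cong_prefix[OF assms(1,2) rel(2)] free_product_cong_append[OF assms(1)]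
      free_product_cong_refl[OF assms(1,2) rel(3)] by blast
qed (blast intro: free_product_cong_sym free_product_cong_trans)+

section \<open>Unique factorisation and equality in M\<close>

locale weak_compression =
  fixes A :: "'a set" and R :: "('a list \<times> 'a list) set" and \<alpha> :: "'a list"
  assumes presentation: "finite_presentation A R"
    and compressible: "weakly_compressible_wrt A R \<alpha>"
begin

abbreviation "S \<equiv> Sigma_star A \<alpha>"
abbreviation "LR \<equiv> left_rels A R \<alpha>"
abbreviation "G \<equiv> left_alphabet A R \<alpha>"
abbreviation "left_cong \<equiv> pres_cong S LR"

lemma R_lists: "R \<subseteq> lists A \<times> lists A" and finite_A: "finite A" and finite_R: "finite R"
  using presentation by (auto simp: finite_presentation_def)

lemma \<alpha>_lists: "\<alpha> \<in> lists A" and \<alpha>_not_Nil: "\<alpha> \<noteq> []"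
  using compressible by (auto simp: weakly_compressible_wrt_def)

lemma no_overlap: "x \<noteq> [] \<Longrightarrow> strict_prefix x \<alpha> \<Longrightarrow> strict_suffix x \<alpha> \<Longrightarrow> False"
  using compressible \<alpha>_not_Nil by (auto simp: weakly_compressible_wrt_def self_overlap_free_def)

lemma LR_lists: "LR \<subseteq> lists S \<times> lists S" by (auto simp: left_rels_def)

lemma LR_lists_G: "LR \<subseteq> lists G \<times> lists G" by (fastforce simp: left_alphabet_def)

lemma G_subset: "G \<subseteq> S" using LR_lists by (fastforce simp: left_alphabet_def)

lemma concat_lists: "us \<in> lists S \<Longrightarrow> concat us \<in> lists A"
  using \<alpha>_lists by (induction us) (auto simp: Sigma_star_def)

lemma prefix_concat: "us \<in> lists S \<Longrightarrow> concat us = [] \<or> prefix \<alpha> (concat us)"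
  by (cases us) (auto simp: Sigma_star_def)

text \<open>If \<open>d\<close> is non-empty, \<open>d @ r'\<close> begins with
  \<open>\<alpha>\<close>, which does not fit into \<open>d\<close>. So
  \<open>\<alpha> = d @ e\<close> with \<open>e\<close> a non-empty prefix of \<open>r'\<close>; as
  \<open>r'\<close> begins with \<open>\<alpha>\<close> too, \<open>e\<close> is an overlap of
  \<open>\<alpha>\<close> with itself.\<close>

lemma no_overlap_append:
  assumes "\<not> sublist \<alpha> (z @ d)" "d @ r' = r" "r = [] \<or> prefix \<alpha> r" "r' = [] \<or> prefix \<alpha> r'"
  shows "d = []"
proof (rule ccontr)
  assume d: "d \<noteq> []"
  then have "prefix \<alpha> (d @ r')" using assms(2,3) by auto
  moreover have not: "\<not> prefix \<alpha> d"
    using assms(1) by (meson prefix_imp_sublist sublist_appendI sublist_order.order_trans sublist_append_leftI)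
  ultimately obtain e where e: "\<alpha> = d @ e" "prefix e r'" by (auto simp: prefix_append)
  then have "e \<noteq> []" using not by auto
  then have "prefix \<alpha> r'" using e(2) assms(4) by auto
  then have "prefix e \<alpha>" using e d by (metis prefix_length_prefix length_append le_add2)
  then have "strict_prefix e \<alpha>" using e(1) d by (auto simp: strict_prefix_def)
  moreover have "strict_suffix e \<alpha>" using e(1) d by (auto simp: strict_suffix_def suffix_def)
  ultimately show False using no_overlap \<open>e \<noteq> []\<close> by blast
qed

text \<open>The surplus \<open>d\<close> of the longer first factor is empty by
  \<open>no_overlap_append\<close>, since both remainders are empty or begin with
  \<open>\<alpha>\<close>.\<close>

lemma concat_inject:
  "us \<in> lists S \<Longrightarrow> vs \<in> lists S \<Longrightarrow> concat us = concat vs \<Longrightarrow> us = vs"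
proof (induction us arbitrary: vs)
  case Nil
  then show ?case using \<alpha>_not_Nil by (cases vs) (auto simp: Sigma_star_def)
next
  case (Cons u us)
  then obtain v vs' where vs: "vs = v # vs'" using \<alpha>_not_Nil by (cases vs) (auto simp: Sigma_star_def)
  from Cons.prems vs obtain y z where yz: "u = \<alpha> @ y" "v = \<alpha> @ z" "\<not> sublist \<alpha> y" "\<not> sublist \<alpha> z"
    by (auto simp: Sigma_star_def)
  have pre: "concat us = [] \<or> prefix \<alpha> (concat us)" "concat vs' = [] \<or> prefix \<alpha> (concat vs')"
    using prefix_concat[of us] prefix_concat[of vs'] Cons.prems(1,2) vs by simp_all
  have "y @ concat us = z @ concat vs'" using Cons.prems(3) vs yz by simp
  then obtain d where "y = z @ d \<and> d @ concat us = concat vs' \<or> y @ d = z \<and> concat us = d @ concat vs'"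
    by (auto simp: append_eq_append_conv2)
  then have "y = z \<and> concat us = concat vs'"
    using no_overlap_append[of z d "concat us" "concat vs'"] no_overlap_append[of y d "concat vs'" "concat us"]
      pre yz(3,4) by auto
  moreover from this have "us = vs'" using Cons.IH[of vs'] Cons.prems vs by simp
  ultimately show ?case using vs yz by simp
qed

text \<open>An occurrence of \<open>\<alpha>\<close> in \<open>y\<close> cuts
  \<open>\<alpha> @ y\<close> into two words of the same form with shorter tails.\<close>

lemma factorization: "y \<in> lists A \<Longrightarrow> \<exists>us\<in>lists S. us \<noteq> [] \<and> \<alpha> @ y = concat us"
proof (induction y rule: length_induct)
  case (1 y)
  show ?case
  proof (cases "sublist \<alpha> y")
    case False
    then show ?thesis using 1 by (intro bexI[of _ "[\<alpha> @ y]"]) (auto simp: Sigma_star_def)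
  next
    case True
    then obtain p q where y: "y = p @ \<alpha> @ q" by (auto simp: sublist_def)
    then have "length p < length y" "length q < length y" "p \<in> lists A" "q \<in> lists A"
      using \<alpha>_not_Nil 1(2) by auto
    then obtain us vs where "us \<in> lists S" "us \<noteq> []" "\<alpha> @ p = concat us" "vs \<in> lists S" "\<alpha> @ q = concat vs"
      using 1(1) by meson
    moreover from this have "\<alpha> @ y = concat (us @ vs)" using y by (metis append.assoc concat_append)
    ultimately show ?thesis by (intro bexI[of _ "us @ vs"]) auto
  qed
qed

text \<open>If \<open>z\<close> is non-empty, then \<open>\<alpha> = d @ z\<close> with
  \<open>d\<close> non-empty, and comparing \<open>\<alpha> @ z\<close> with its suffix
  \<open>\<alpha>\<close> gives \<open>\<alpha> = f @ d\<close>: the word \<open>d\<close> is an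
  overlap.\<close>

lemma suffix_free:
  assumes "suffix \<alpha> (w @ \<alpha> @ z)" "\<not> sublist \<alpha> z"
  shows "z = []"
proof (rule ccontr)
  assume z: "z \<noteq> []"
  have "\<not> suffix \<alpha> z" using assms(2) by (meson suffix_imp_sublist)
  then have "suffix z \<alpha>"
    using assms(1) suffix_same_cases[of \<alpha> "w @ \<alpha> @ z" z] by (auto simp: suffix_def)
  then obtain d where d: "\<alpha> = d @ z" by (auto simp: suffix_def)
  then have "d \<noteq> []" using assms(2) by auto
  have "suffix \<alpha> (\<alpha> @ z)"
    using suffix_length_suffix[OF assms(1), of "\<alpha> @ z"] by (simp add: suffix_def)
  then obtain f where "\<alpha> @ z = f @ \<alpha>" by (auto simp: suffix_def)
  then have f: "\<alpha> = f @ d" using d by (metis append.assoc append_same_eq)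
  then have "f \<noteq> []" using d z by auto
  then have "strict_suffix d \<alpha>" unfolding f by (simp add: strict_suffix_def suffix_def)
  moreover have "strict_prefix d \<alpha>" unfolding d using z by (simp add: strict_prefix_def)
  ultimately show False using no_overlap \<open>d \<noteq> []\<close> by blast
qed

lemma sealed_factorization:
  assumes "u \<in> lists A" "prefix \<alpha> u" "suffix \<alpha> u"
  shows "\<exists>us\<in>lists S. u = concat us @ \<alpha>"
proof -
  from assms(2) obtain y where "u = \<alpha> @ y" by (auto simp: prefix_def)
  with assms(1) have y: "u = \<alpha> @ y" "y \<in> lists A" by auto
  from factorization[OF y(2)] obtain us where us: "us \<in> lists S" "us \<noteq> []" "u = concat us"
    using y(1) by auto
  then obtain vs v where vs: "us = vs @ [v]" by (cases us rule: rev_cases) auto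
  then obtain z where z: "v = \<alpha> @ z" "\<not> sublist \<alpha> z" using us(1) by (auto simp: Sigma_star_def)
  \<comment> \<open>The last factor is exactly \<open>\<alpha>\<close>, the seal at the end of
    \<open>u\<close>.\<close>
  have "z = []" by (rule suffix_free[of "concat vs"]) (use assms(3) us(3) vs z in auto)
  then show ?thesis using us vs z by auto
qed

lemma R_factorization:
  assumes "(u, v) \<in> R"
  obtains us vs where "(us, vs) \<in> LR" "u = concat us @ \<alpha>" "v = concat vs @ \<alpha>"
proof -
  have "prefix \<alpha> u" "suffix \<alpha> u" "prefix \<alpha> v" "suffix \<alpha> v"
    using compressible assms by (auto simp: weakly_compressible_wrt_def sealed_def)
  moreover have "u \<in> lists A" "v \<in> lists A" using R_lists assms by auto
  ultimately show ?thesis using sealed_factorization that assms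
    by (metis (mono_tags, lifting) left_rels_def case_prodI mem_Collect_eq)
qed

text \<open>Unique factorisation makes the map back to \<open>R\<close> injective.\<close>

lemma finite_LR: "finite LR"
proof (rule finite_imageD)
  let ?f = "\<lambda>(us, vs). (concat us @ \<alpha>, concat vs @ \<alpha>)"
  show "finite (?f ` LR)"
    using finite_R by (rule finite_subset[rotated]) (auto simp: left_rels_def)
  show "inj_on ?f LR"
    using concat_inject by (auto simp: inj_on_def left_rels_def)
qed

lemma finite_G: "finite G"
  unfolding left_alphabet_def using finite_LR by auto

lemma concat_append_\<alpha>:
  assumes "s \<in> lists S"
  obtains s' where "s' \<in> lists A" "concat s @ \<alpha> = \<alpha> @ s'"
proof (cases s)
  case Nil
  then show ?thesis using that[of "[]"] by simp
next
  case (Cons x s')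
  then obtain z where "x = \<alpha> @ z" "z \<in> lists A" using assms by (auto simp: Sigma_star_def)
  then show ?thesis using that[of "z @ concat s' @ \<alpha>"] concat_lists[of s'] \<alpha>_lists assms Cons by auto
qed

text \<open>A relation of M needs an \<open>\<alpha>\<close> after the factors taken from
  \<open>LR\<close>; the rest \<open>concat s @ \<alpha>\<close> begins with one.\<close>

lemma left_cong_sound:
  "(x, y) \<in> left_cong \<Longrightarrow> (concat x @ \<alpha>, concat y @ \<alpha>) \<in> pres_cong A R"
proof (induction rule: pres_cong.induct)
  case (refl w)
  then show ?case using concat_lists \<alpha>_lists by (intro pres_cong.refl) auto
next
  case (rel us vs p s)
  obtain s' where s': "s' \<in> lists A" "concat s @ \<alpha> = \<alpha> @ s'" using rel(3) by (rule concat_append_\<alpha>)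
  have "(concat us @ \<alpha>, concat vs @ \<alpha>) \<in> R" using rel(1) by (auto simp: left_rels_def)
  from pres_cong.rel[OF this concat_lists[OF rel(2)] s'(1)] show ?case by (simp add: s'(2))
qed (blast intro: pres_cong.sym pres_cong.trans)+

text \<open>Equality in L(M) between words over \<open>G\<close>, spelled out over \<open>A\<close>.
  As L(M) is a submonoid, its equality is that of the extended left monoid, whence
  \<open>left_cong\<close> over all of \<open>S\<close>.\<close>

definition "left_pairs = {(concat x, concat y) | x y. x \<in> lists G \<and> y \<in> lists G \<and> (x, y) \<in> left_cong}"

abbreviation "sealed_rel \<equiv> sealed_pairs A \<alpha> left_pairs"

lemma sealed_rel_sound: "sealed_rel u v \<Longrightarrow> (u, v) \<in> pres_cong A R"
proof (induction rule: sealed_pairs.induct)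
  case Nil
  then show ?case by (auto intro: pres_cong.refl)
next
  case (letter a u v)
  then show ?case using pres_cong_append[OF R_lists letter.IH, of "[a]" "[]"] by simp
next
  case (seal x y u v)
  have "(x @ \<alpha>, y @ \<alpha>) \<in> pres_cong A R"
    using seal.hyps(1) left_cong_sound by (auto simp: left_pairs_def)
  from pres_cong_append2[OF R_lists this seal.IH] show ?case by simp
qed

lemma sealed_rel_prefix: "p \<in> lists A \<Longrightarrow> sealed_rel u v \<Longrightarrow> sealed_rel (p @ u) (p @ v)"
  by (induction p) (auto intro: sealed_pairs.letter)

lemma sealed_rel_refl: "w \<in> lists A \<Longrightarrow> sealed_rel w w"
  using sealed_rel_prefix[OF _ sealed_pairs.Nil] by fastforce

text \<open>The \<open>\<alpha>\<close> at the start of a letter \<open>s = \<alpha> @ z\<close>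
  outside \<open>G\<close> seals the block before it, and \<open>z\<close> is then a common prefix;
  the last block is sealed by the \<open>\<alpha>\<close> in front of \<open>w\<close>.\<close>

lemma sealed_rel_concat:
  assumes "free_product_cong S G left_cong m n" "w \<in> lists A"
  shows "sealed_rel (concat m @ \<alpha> @ w) (concat n @ \<alpha> @ w)"
  using assms(1)
proof induction
  case (base x y)
  then show ?case
    using sealed_pairs.seal[OF _ sealed_rel_refl[OF assms(2)], of "concat x" "concat y"]
    by (auto simp: left_pairs_def)
next
  case (step x y s u v)
  from step.hyps obtain z where z: "s = \<alpha> @ z" "z \<in> lists A" by (auto simp: Sigma_star_def)
  have "(concat x, concat y) \<in> left_pairs" using step.hyps by (auto simp: left_pairs_def)
  from sealed_pairs.seal[OF this sealed_rel_prefix[OF z(2) step.IH]] show ?case by (simp add: z(1))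
qed

text \<open>The \<open>\<alpha>\<close> put in front becomes the start of \<open>f\<close>, and the
  one ending a relation word becomes the start of \<open>\<alpha> @ s\<close>, so a relation only
  changes factors between the first and the last. Equal words are kept apart because
  \<open>\<alpha> @ u\<close> may be a single factor.\<close>

lemma pres_cong_decomposition:
  "(u, v) \<in> pres_cong A R \<Longrightarrow> u = v \<and> u \<in> lists A \<or>
    (\<exists>f m n l. f \<in> S \<and> l \<in> S \<and> (m, n) \<in> left_cong \<and> \<alpha> @ u = concat (f # m @ [l]) \<and> \<alpha> @ v = concat (f # n @ [l]))"
proof (induction rule: pres_cong.induct)
  case (refl w)
  then show ?case by simp
next
  case (rel u v p s)
  from rel(1) obtain us vs where us: "(us, vs) \<in> LR" "u = concat us @ \<alpha>" "v = concat vs @ \<alpha>"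
    by (rule R_factorization)
  from factorization[OF rel(2)] obtain f ps where p: "f \<in> S" "ps \<in> lists S" "\<alpha> @ p = f @ concat ps"
    by (metis concat.simps(2) listsE neq_Nil_conv)
  from factorization[OF rel(3)] obtain ts where "ts \<in> lists S" "ts \<noteq> []" "\<alpha> @ s = concat ts" by blast
  then obtain ss l where s: "l \<in> S" "ss \<in> lists S" "\<alpha> @ s = concat ss @ l"
    by (cases ts rule: rev_cases) auto
  have "\<alpha> @ p @ (concat xs @ \<alpha>) @ s = concat (f # (ps @ xs @ ss) @ [l])" for xs
  proof -
    have "\<alpha> @ p @ (concat xs @ \<alpha>) @ s = (\<alpha> @ p) @ concat xs @ (\<alpha> @ s)" by simp
    also have "\<dots> = concat (f # (ps @ xs @ ss) @ [l])" unfolding p(3) s(3) by simp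
    finally show ?thesis .
  qed
  then show ?case using pres_cong.rel[OF us(1) p(2) s(2)] p(1) s(1) us(2,3) by blast
next
  case (sym u v)
  then show ?case by (blast intro: pres_cong.sym)
next
  case (trans u v w)
  show ?case
  proof (cases "u = v \<or> v = w")
    case True
    then show ?thesis using trans.IH by blast
  next
    case False
    then obtain f m n l f' m' n' l' where
      1: "f \<in> S" "l \<in> S" "(m, n) \<in> left_cong" "\<alpha> @ u = concat (f # m @ [l])" "\<alpha> @ v = concat (f # n @ [l])"
      and 2: "f' \<in> S" "l' \<in> S" "(m', n') \<in> left_cong" "\<alpha> @ v = concat (f' # m' @ [l'])" "\<alpha> @ w = concat (f' # n' @ [l'])"
      using trans.IH by blast
    \<comment> \<open>Both decompositions factorise the middle word \<open>\<alpha> @ v\<close>,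
      hence they agree on it.\<close>
    have "f # n @ [l] = f' # m' @ [l']"
      by (rule concat_inject)
        (use 1 2 pres_cong_in_lists[OF LR_lists 1(3)] pres_cong_in_lists[OF LR_lists 2(3)] in auto)
    then have "f = f'" "n = m'" "l = l'" by auto
    then show ?thesis using 1 2 pres_cong.trans[OF 1(3)] by blast
  qed
qed

lemma sealed_rel_complete:
  assumes "(u, v) \<in> pres_cong A R"
  shows "sealed_rel u v"
  using pres_cong_decomposition[OF assms]
proof (elim disjE exE conjE)
  fix f m n l
  assume *: "f \<in> S" "l \<in> S" "(m, n) \<in> left_cong" "\<alpha> @ u = concat (f # m @ [l])" "\<alpha> @ v = concat (f # n @ [l])"
  \<comment> \<open>Cancelling the leading \<open>\<alpha>\<close> gives
    \<open>u = p @ concat m @ \<alpha> @ s\<close>, and likewise for \<open>v\<close> with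
    \<open>n\<close>.\<close>
  from *(1,2) obtain p s where ps: "f = \<alpha> @ p" "l = \<alpha> @ s" "p \<in> lists A" "s \<in> lists A"
    by (auto simp: Sigma_star_def)
  have "free_product_cong S G left_cong m n"
    by (rule pres_cong_imp_free_product_cong[OF LR_lists G_subset LR_lists_G *(3)])
  from sealed_rel_prefix[OF ps(3) sealed_rel_concat[OF this ps(4)]] show ?thesis
    using *(4,5) ps(1,2) by simp
qed (use sealed_rel_refl in auto)

lemma word_class_eq_iff:
  assumes "u \<in> lists A" "v \<in> lists A"
  shows "word_class A R u = word_class A R v \<longleftrightarrow> sealed_rel u v"
  using eq_equiv_class_iff[OF equiv_pres_cong[OF R_lists] assms] sealed_rel_complete sealed_rel_sound
  by (auto simp: word_class_def)

section \<open>From the word problem of L(M) to \<open>left_pairs\<close>\<close>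

lemma left_monoid_generators:
  assumes "g \<in> G"
  shows "word_class S LR [g] \<in> carrier (left_monoid A R \<alpha>)"
  using assms by (auto simp: left_monoid_def submonoid_generated_def)

text \<open>The generators \<open>B\<close> are arbitrary, so each \<open>g\<close> in
  \<open>G\<close> is represented by a word \<open>\<beta> g\<close> over \<open>B\<close>. The
  transducer inverts the resulting homomorphism \<open>h\<close> on both sides of the separator and
  outputs words over \<open>A\<close>.\<close>

lemma context_free_left_pairs:
  fixes B :: "'b set"
  assumes fg: "finitely_generated_via (left_monoid A R \<alpha>) B \<pi>"
    and cf: "context_free (word_problem B \<pi>)"
  shows "context_free {pair_word x y | x y. (x, y) \<in> left_pairs}"
proof -
  have \<pi>_append: "\<pi> (u @ v) = \<pi> u \<otimes>\<^bsub>presented_monoid S LR\<^esub> \<pi> v" if "u \<in> lists B" "v \<in> lists B" for u v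
    using fg that hom_mult[of \<pi> "free_monoid B" "left_monoid A R \<alpha>" u v]
    by (simp add: finitely_generated_via_def free_monoid_def left_monoid_def extended_left_monoid_def)
  have \<pi>_Nil: "\<pi> [] = word_class S LR []"
    using fg by (simp add: finitely_generated_via_def free_monoid_def left_monoid_def
        extended_left_monoid_def presented_monoid_def)
  have "\<pi> ` lists B = carrier (left_monoid A R \<alpha>)"
    using fg by (simp add: finitely_generated_via_def free_monoid_def)
  then have "\<forall>g\<in>G. \<exists>b. b \<in> lists B \<and> \<pi> b = word_class S LR [g]"
    using left_monoid_generators by (metis imageE)
  from bchoice[OF this] obtain \<beta> where
    \<beta>: "\<And>g. g \<in> G \<Longrightarrow> \<beta> g \<in> lists B" "\<And>g. g \<in> G \<Longrightarrow> \<pi> (\<beta> g) = word_class S LR [g]"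
    by auto
  define h where "h x = concat (map \<beta> x)" for x
  have h_lists: "h x \<in> lists B" if "x \<in> lists G" for x
    using that \<beta>(1) by (induction x) (auto simp: h_def)
  have \<pi>_h: "\<pi> (h x) = word_class S LR x" if "x \<in> lists G" for x
    using that
  proof (induction x)
    case Nil
    then show ?case by (simp add: h_def \<pi>_Nil)
  next
    case (Cons g x)
    have "\<pi> (h (g # x)) = \<pi> (\<beta> g @ h x)" by (simp add: h_def)
    also have "\<dots> = word_class S LR [g] \<otimes>\<^bsub>presented_monoid S LR\<^esub> word_class S LR x"
      using Cons \<beta> h_lists by (simp add: \<pi>_append)
    also have "\<dots> = word_class S LR (g # x)"
      using mult_word_class[OF LR_lists, of "[g]" x] Cons.hyps G_subset by auto
    finally show ?case .
  qed
  have h_eq: "\<pi> (h x) = \<pi> (h y) \<longleftrightarrow> (x, y) \<in> left_cong" if "x \<in> lists G" "y \<in> lists G" for x y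
  proof -
    have "x \<in> lists S" "y \<in> lists S" using that G_subset by auto
    then show ?thesis
      using eq_equiv_class_iff[OF equiv_pres_cong[OF LR_lists]] by (simp add: \<pi>_h that word_class_def)
  qed
  txt \<open>A state of the transducer is the side of the separating symbol that is being read, together
    with the unread rest of the image of the last generator whose word has been output.\<close>
  define W where "W = (\<Union>g\<in>G. set (suffixes (\<beta> g)) \<union> set (suffixes (rev (\<beta> g))))"
  \<comment> \<open>A generator is guessed by a silent move that outputs its word at once; the later
    moves check that its image is indeed read.\<close>
  define \<Delta> where "\<Delta> =
    (\<lambda>g. ((False, []), None, map Some g, (False, \<beta> g))) ` G \<union>
    (\<lambda>g. ((True, []), None, map Some (rev g), (True, rev (\<beta> g)))) ` G \<union>
    {((False, []), Some None, [None], (True, []))} \<union>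
    (\<lambda>(side, w). ((side, w), Some (Some (hd w)), [], (side, tl w))) ` (UNIV \<times> (W - {[]}))"
  have "finite \<Delta>" using finite_G by (simp add: \<Delta>_def W_def)
  have read: "((side, b # w), Some (Some b), [], (side, w)) \<in> \<Delta>" if "b # w \<in> W" for side b w
    unfolding \<Delta>_def using that by (intro UnI2 image_eqI[of _ _ "(side, b # w)"]) auto
  have \<Delta>_cases: "(\<exists>g\<in>G. \<not> side \<and> w = [] \<and> i = None \<and> x = map Some g \<and> q = (False, \<beta> g)) \<or>
      (\<exists>g\<in>G. side \<and> w = [] \<and> i = None \<and> x = map Some (rev g) \<and> q = (True, rev (\<beta> g))) \<or>
      (\<not> side \<and> w = [] \<and> i = Some None \<and> x = [None] \<and> q = (True, [])) \<or>
      (\<exists>b v. w = b # v \<and> i = Some (Some b) \<and> x = [] \<and> q = (side, v))"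
    if "((side, w), i, x, q) \<in> \<Delta>" for side w i x q
    using that unfolding \<Delta>_def by (elim UnE imageE) (auto simp: neq_Nil_conv)
  \<comment> \<open>The rest \<open>w\<close> precedes the images of the generators guessed later.
    Right of the separator all words are reversed, so the generators appear there from the last to
    the first.\<close>
  have sound: "if side then \<exists>y\<in>lists G. z = map Some (w @ rev (h y)) \<and> o' = map Some (rev (concat y))
      else \<exists>x\<in>lists G. \<exists>y\<in>lists G. z = pair_word (w @ h x) (h y) \<and> o' = pair_word (concat x) (concat y)"
    if "transduces \<Delta> (side, w) z o' (True, [])" for side w z o'
    using that
  proof (induction "(side, w)" z o' "(True, [] :: 'b list)" arbitrary: side w rule: transduces.induct)
    case refl
    then show ?case by (auto simp: h_def intro!: bexI[of _ "[]"])
  next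
    case (eps x s' z o')
    from \<Delta>_cases[OF eps.hyps(1)] consider
        g where "g \<in> G" "\<not> side" "w = []" "x = map Some g" "s' = (False, \<beta> g)"
      | g where "g \<in> G" "side" "w = []" "x = map Some (rev g)" "s' = (True, rev (\<beta> g))"
      by auto
    then show ?case
    proof cases
      case 1
      from eps.hyps(3)[OF 1(5)] obtain xs ys where "xs \<in> lists G" "ys \<in> lists G"
        "z = pair_word (\<beta> g @ h xs) (h ys)" "o' = pair_word (concat xs) (concat ys)" by auto
      then have "g # xs \<in> lists G" "ys \<in> lists G" "z = pair_word ([] @ h (g # xs)) (h ys)"
        "x @ o' = pair_word (concat (g # xs)) (concat ys)"
        using 1 by (simp_all add: h_def pair_word_def)
      show ?thesis unfolding if_not_P[OF 1(2)] 1(3)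
        by (rule bexI[of _ "g # xs"], rule bexI[of _ ys], intro conjI) fact+
    next
      case 2
      from eps.hyps(3)[OF 2(5)] obtain ys where "ys \<in> lists G"
        "z = map Some (rev (\<beta> g) @ rev (h ys))" "o' = map Some (rev (concat ys))" by auto
      then show ?thesis using 2
        by (auto intro!: bexI[of _ "ys @ [g]"] simp: h_def)
    qed
  next
    case (read a x s' z o')
    from \<Delta>_cases[OF read.hyps(1)] consider
        "\<not> side" "w = []" "a = None" "x = [None]" "s' = (True, [])"
      | b v where "w = b # v" "a = Some b" "x = []" "s' = (side, v)"
      by auto
    then show ?case
    proof cases
      case 1
      from read.hyps(3)[OF 1(5)] obtain ys where "ys \<in> lists G"
        "z = map Some (rev (h ys))" "o' = map Some (rev (concat ys))" by auto
      then have "[] \<in> lists G" "ys \<in> lists G" "a # z = pair_word ([] @ h []) (h ys)"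
        "x @ o' = pair_word (concat []) (concat ys)"
        using 1 by (simp_all add: h_def pair_word_def rev_map)
      show ?thesis unfolding if_not_P[OF 1(1)] 1(2)
        by (rule bexI[of _ "[]"], rule bexI[of _ ys], intro conjI) fact+
    next
      case 2
      then show ?thesis using read.hyps(3)[OF 2(4)] by (auto simp: pair_word_def split: if_splits)
    qed
  qed
  have drain: "transduces \<Delta> (side, w) (map Some w @ z) o' t"
    if "transduces \<Delta> (side, []) z o' t" "w \<in> W" for side w z o' t
    using that(2)
  proof (induction w)
    case Nil
    then show ?case using that(1) by simp
  next
    case (Cons b w)
    then have "w \<in> W" unfolding W_def by (auto dest: suffix_ConsD)
    from transduces.read[OF read[OF Cons.prems] Cons.IH[OF this]] show ?case by simp
  qed
  have W: "\<beta> g \<in> W" "rev (\<beta> g) \<in> W" if "g \<in> G" for g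
    using that by (auto simp: W_def)
  have right: "transduces \<Delta> (True, []) (map Some (rev (h y))) (map Some (rev (concat y))) (True, [])"
    if "y \<in> lists G" for y
    using that
  proof (induction y rule: rev_induct)
    case Nil
    then show ?case by (simp add: h_def transduces.refl)
  next
    case (snoc g y)
    then have "((True, []), None, map Some (rev g), (True, rev (\<beta> g))) \<in> \<Delta>"
      by (auto simp: \<Delta>_def)
    from transduces.eps[OF this drain[OF snoc.IH W(2)]] snoc.prems show ?case by (simp add: h_def)
  qed
  have left: "transduces \<Delta> (False, []) (pair_word (h x) (h y)) (pair_word (concat x) (concat y)) (True, [])"
    if "x \<in> lists G" "y \<in> lists G" for x y
    using that(1)
  proof (induction x)
    case Nil
    have "((False, []), Some None, [None], (True, [])) \<in> \<Delta>" by (auto simp: \<Delta>_def)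
    from transduces.read[OF this right[OF that(2)]] show ?case by (simp add: h_def pair_word_def rev_map)
  next
    case (Cons g x)
    then have "((False, []), None, map Some g, (False, \<beta> g)) \<in> \<Delta>"
      by (auto simp: \<Delta>_def)
    from transduces.eps[OF this drain[OF Cons.IH W(1)]] Cons.hyps show ?case
      by (simp add: h_def pair_word_def)
  qed
  have "{x. \<exists>z\<in>word_problem B \<pi>. transduces \<Delta> (False, []) z x (True, [])} =
    {pair_word x y | x y. (x, y) \<in> left_pairs}"
  proof (intro equalityI subsetI)
    fix w assume "w \<in> {x. \<exists>z\<in>word_problem B \<pi>. transduces \<Delta> (False, []) z x (True, [])}"
    then obtain u v where uv: "\<pi> u = \<pi> v" "transduces \<Delta> (False, []) (pair_word u v) w (True, [])"
      by (auto simp: word_problem_def pair_word_def)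
    from sound[OF uv(2)] obtain x y where "x \<in> lists G" "y \<in> lists G" "u = h x" "v = h y"
      "w = pair_word (concat x) (concat y)" by auto
    then show "w \<in> {pair_word x y | x y. (x, y) \<in> left_pairs}"
      using uv(1) h_eq unfolding left_pairs_def by blast
  next
    fix w assume "w \<in> {pair_word x y | x y. (x, y) \<in> left_pairs}"
    then obtain x y where xy: "x \<in> lists G" "y \<in> lists G" "(x, y) \<in> left_cong"
      "w = pair_word (concat x) (concat y)" by (auto simp: left_pairs_def)
    then have "pair_word (h x) (h y) \<in> word_problem B \<pi>"
      using h_eq h_lists unfolding word_problem_def pair_word_def by blast
    then show "w \<in> {x. \<exists>z\<in>word_problem B \<pi>. transduces \<Delta> (False, []) z x (True, [])}"
      using left[OF xy(1,2)] xy(4) by blast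
  qed
  then show ?thesis
    using context_free_transduction[OF cf \<open>finite \<Delta>\<close>, of "(False, [])" "(True, [])"] by simp
qed

theorem context_free_word_problem:
  assumes "finitely_generated_via (left_monoid A R \<alpha>) B \<pi>" "context_free (word_problem B \<pi>)"
  shows "context_free (word_problem A (word_class A R))"
proof -
  have "word_problem A (word_class A R) = {pair_word u v | u v. sealed_rel u v}"
    using word_class_eq_iff sealed_rel_sound pres_cong_in_lists[OF R_lists]
    unfolding word_problem_def pair_word_def by blast
  then show ?thesis
    using context_free_sealed[OF finite_A context_free_left_pairs[OF assms], of \<alpha>] by simp
qed

end

section \<open>Intersecting a context-free language with a regular language\<close>

inductive automaton_path :: "(nat \<Rightarrow> 't \<Rightarrow> nat \<Rightarrow> bool) \<Rightarrow> nat \<Rightarrow> 't list \<Rightarrow> nat \<Rightarrow> bool" for D where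
  Nil: "automaton_path D s [] s"
| Cons: "D s a r \<Longrightarrow> automaton_path D r w t \<Longrightarrow> automaton_path D s (a # w) t"

inductive_simps automaton_path_Nil [simp]: "automaton_path D s [] t"
inductive_simps automaton_path_Cons: "automaton_path D s (a # w) t"

lemma automaton_path_append:
  "automaton_path D s (u @ v) t \<longleftrightarrow> (\<exists>r. automaton_path D s u r \<and> automaton_path D r v t)"
  by (induction u arbitrary: s) (auto simp: automaton_path_Cons)

text \<open>\<open>N\<close> is a candidate for the reachability relation of the nonterminals.
  Intermediate states are bounded by \<open>b\<close> to keep the condition recursive.\<close>

fun chain :: "(nat \<Rightarrow> nat \<Rightarrow> nat \<Rightarrow> bool) \<Rightarrow> (nat \<Rightarrow> 't \<Rightarrow> nat \<Rightarrow> bool) \<Rightarrow> nat \<Rightarrow>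
    (nat, 't) sym list \<Rightarrow> nat \<Rightarrow> nat \<Rightarrow> bool" where
  "chain N D b [] s t \<longleftrightarrow> s = t"
| "chain N D b (Nt X # ss) s t \<longleftrightarrow> (\<exists>r<b. N X s r \<and> chain N D b ss r t)"
| "chain N D b (Tm a # ss) s t \<longleftrightarrow> (\<exists>r<b. D s a r \<and> chain N D b ss r t)"

definition closed_under :: "(nat, 't) prods \<Rightarrow> (nat \<Rightarrow> nat \<Rightarrow> nat \<Rightarrow> bool) \<Rightarrow>
    (nat \<Rightarrow> 't \<Rightarrow> nat \<Rightarrow> bool) \<Rightarrow> nat \<Rightarrow> bool" where
  "closed_under P N D b \<longleftrightarrow> (\<forall>X\<in>P. \<forall>s<b. \<forall>t<b. chain N D b (snd X) s t \<longrightarrow> N (fst X) s t)"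

lemma chain_mono:
  "chain N D b ss s t \<Longrightarrow> (\<And>X s t. N X s t \<Longrightarrow> N' X s t) \<Longrightarrow> chain N' D b ss s t"
  by (induction N D b ss s t rule: chain.induct) auto

text \<open>Every step of \<open>D\<close> ends below \<open>b\<close>, so the states between the
  parts of a derived word lie in the bounded range, and closure of \<open>N\<close> supplies each
  nonterminal.\<close>

lemma chain_if_gen:
  assumes D: "\<And>s a t. D s a t \<Longrightarrow> t < b" and N: "closed_under P N D b"
    and "gen P ss w" "automaton_path D s w t" "s < b"
  shows "chain N D b ss s t"
proof -
  have bound: "t < b" if "automaton_path D s w t" "s < b" for s w t
    using that by induction (auto dest: D)
  show ?thesis
    using assms(3-)
  proof (induction arbitrary: s t)
    case (Tm ss w a)
    then show ?case by (auto simp: automaton_path_Cons dest: D)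
  next
    case (Nt X \<beta> u ss v)
    from Nt.prems(1) obtain r where r: "automaton_path D s u r" "automaton_path D r v t"
      by (auto simp: automaton_path_append)
    have "r < b" using bound[OF r(1) Nt.prems(2)] .
    moreover from this have "N X s r"
      using Nt.IH(1)[OF r(1) Nt.prems(2)] N Nt.hyps(1) Nt.prems(2) by (fastforce simp: closed_under_def)
    ultimately show ?case using Nt.IH(2)[OF r(2)] by auto
  qed simp
qed

lemma gen_if_chain:
  "chain (\<lambda>X s t. \<exists>w. gen P [Nt X] w \<and> automaton_path D s w t) D b ss s t \<Longrightarrow>
    \<exists>w. gen P ss w \<and> automaton_path D s w t"
proof (induction ss arbitrary: s)
  case (Cons Y ss)
  show ?case
  proof (cases Y)
    case (Nt X)
    with Cons.prems obtain r u where r: "gen P [Nt X] u" "automaton_path D s u r"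
      "chain (\<lambda>X s t. \<exists>w. gen P [Nt X] w \<and> automaton_path D s w t) D b ss r t" by auto
    from Cons.IH[OF r(3)] obtain v where v: "gen P ss v" "automaton_path D r v t" by blast
    have "automaton_path D s (u @ v) t" unfolding automaton_path_append using r(2) v(2) by blast
    then show ?thesis using gen_append[OF r(1) v(1)] Nt by auto
  next
    case (Tm a)
    with Cons.prems obtain r where r: "D s a r"
      "chain (\<lambda>X s t. \<exists>w. gen P [Nt X] w \<and> automaton_path D s w t) D b ss r t" by auto
    from Cons.IH[OF r(2)] obtain v where "gen P ss v" "automaton_path D r v t" by blast
    then have "gen P (Y # ss) (a # v)" "automaton_path D s (a # v) t"
      using Tm r(1) by (auto simp: automaton_path_Cons)
    then show ?thesis by blast
  qed
qed auto

text \<open>A finite set of triples is coded by the number whose binary digits mark its members, so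
  quantifying over tables is quantifying over numbers.\<close>

abbreviation table :: "nat \<Rightarrow> nat \<Rightarrow> nat \<Rightarrow> nat \<Rightarrow> bool" where
  "table T X s t \<equiv> pair X (pair s t) \<in> set_decode T"

lemma pair_mono: "m \<le> m' \<Longrightarrow> n \<le> n' \<Longrightarrow> pair m n \<le> pair m' n'"
  using triangle_mono[of "m + n" "m' + n'"] by (simp add: prod_encode_eq_triangle)

lemma set_encode_less:
  assumes "M \<subseteq> {..<K}"
  shows "set_encode M < 2 ^ K"
proof -
  have "set_encode M \<le> (\<Sum>k<K. 2 ^ k)"
    unfolding set_encode_def using assms by (intro sum_mono2) auto
  also have "\<dots> < 2 ^ K" by (induction K) auto
  finally show ?thesis .
qed

text \<open>The least table closed under the productions is the true reachability relation, and the codes of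
  the tables that matter are bounded.\<close>
lemma reachable_iff_tables:
  assumes D: "\<And>s a t. D s a t \<Longrightarrow> t < b"
    and m: "\<And>X \<beta>. (X, \<beta>) \<in> P \<Longrightarrow> X \<le> m" "S \<le> m" and st: "s < b" "t < b"
  shows "(\<exists>w\<in>cfg_lang P S. automaton_path D s w t) \<longleftrightarrow>
    (\<forall>T<2 ^ Suc (pair m (pair b b)). closed_under P (table T) D b \<longrightarrow> table T S s t)"
proof
  assume "\<exists>w\<in>cfg_lang P S. automaton_path D s w t"
  then obtain w where w: "gen P [Nt S] w" "automaton_path D s w t" by (auto simp: cfg_lang_gen)
  have "table T S s t" if "closed_under P (table T) D b" for T
    using chain_if_gen[OF D that w st(1)] by auto
  then show "\<forall>T<2 ^ Suc (pair m (pair b b)). closed_under P (table T) D b \<longrightarrow> table T S s t" by blast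
next
  assume *: "\<forall>T<2 ^ Suc (pair m (pair b b)). closed_under P (table T) D b \<longrightarrow> table T S s t"
  let ?N = "\<lambda>X s t. \<exists>w. gen P [Nt X] w \<and> automaton_path D s w t"
  \<comment> \<open>True reachability, cut off at \<open>m\<close> and \<open>b\<close> to be
    finite. The cut-off relation is still closed, since \<open>m\<close> bounds all left-hand
    sides.\<close>
  define M where "M = {pair X (pair s t) | X s t. X \<le> m \<and> s < b \<and> t < b \<and> ?N X s t}"
  have M: "M \<subseteq> {..<Suc (pair m (pair b b))}"
    by (auto simp: M_def less_Suc_eq_le intro!: pair_mono)
  then have "finite M" by (rule finite_subset) simp
  then have table: "table (set_encode M) X s t \<longleftrightarrow> X \<le> m \<and> s < b \<and> t < b \<and> ?N X s t" for X s t
    by (auto simp: set_encode_inverse M_def)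
  have "closed_under P (table (set_encode M)) D b"
    unfolding closed_under_def
  proof (intro ballI allI impI)
    fix p s t assume p: "p \<in> P" and st: "s < b" "t < b" and "chain (table (set_encode M)) D b (snd p) s t"
    then have "chain ?N D b (snd p) s t" by (elim chain_mono) (simp add: table)
    from gen_if_chain[OF this] obtain w where "gen P (snd p) w" "automaton_path D s w t" by blast
    then have "?N (fst p) s t" using p unfolding gen_single by (metis prod.collapse)
    then show "table (set_encode M) (fst p) s t" using m(1)[of "fst p" "snd p"] p st by (simp add: table)
  qed
  then have "table (set_encode M) S s t" using * set_encode_less[OF M] by blast
  then show "\<exists>w\<in>cfg_lang P S. automaton_path D s w t" by (auto simp: table cfg_lang_gen)
qed

text \<open>The accessors \<open>T\<close>, \<open>e\<close>, \<open>f\<close> and \<open>g\<close>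
  are generalised in the induction because each bounded quantifier packs a new state in front of the
  argument.\<close>

lemma recursive_chain:
  assumes D: "\<And>a. recursive (\<lambda>z. D (pfst z) (pfst (psnd z)) a (psnd (psnd z)))" and b: "computable b"
  shows "computable T \<Longrightarrow> computable e \<Longrightarrow> computable f \<Longrightarrow> computable g \<Longrightarrow>
    recursive (\<lambda>z. chain (table (T z)) (D (e z)) (b (e z)) ss (f z) (g z))"
proof (induction ss arbitrary: T e f g)
  case Nil
  then show ?case by (simp add: computable)
next
  case (Cons Y ss)
  note [computable] = computable_compose[OF Cons.prems(1)] computable_compose[OF Cons.prems(2)]
    computable_compose[OF Cons.prems(3)] computable_compose[OF Cons.prems(4)] computable_compose[OF b]
  have tail: "recursive (\<lambda>y. chain (table (T (psnd y))) (D (e (psnd y))) (b (e (psnd y))) ss (pfst y) (g (psnd y)))"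
    by (rule Cons.IH) (intro computable)+
  show ?case
  proof (cases Y)
    case (Nt X)
    have "recursive (\<lambda>z. \<exists>r<b (e z). table (T z) X (f z) r \<and>
        chain (table (T z)) (D (e z)) (b (e z)) ss r (g z))"
      by (intro computable tail)
    then show ?thesis using Nt by simp
  next
    case (Tm a)
    have "recursive (\<lambda>y. D (e (psnd y)) (f (psnd y)) a (pfst y))"
      using recursive_compose[OF D, of "\<lambda>y. pair (e (psnd y)) (pair (f (psnd y)) (pfst y))"]
      by (simp add: computable)
    then have "recursive (\<lambda>z. \<exists>r<b (e z). D (e z) (f z) a r \<and>
        chain (table (T z)) (D (e z)) (b (e z)) ss r (g z))"
      by (intro computable tail)
    then show ?thesis using Tm by simp
  qed
qed

text \<open>The grammar is fixed while the automaton varies with the argument. The range conditions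
  are part of the predicate because the table criterion speaks of states below the bound.\<close>

theorem recursive_cfg_reachable:
  fixes P :: "(nat, 't) prods"
  assumes P: "finite P" and D: "\<And>a. recursive (\<lambda>z. D (pfst z) (pfst (psnd z)) a (psnd (psnd z)))"
    and bound: "\<And>x s a t. D x s a t \<Longrightarrow> t < b x"
    and [computable]: "computable b" "computable e" "computable f" "computable g"
  shows "recursive (\<lambda>x. f x < b (e x) \<and> g x < b (e x) \<and>
    (\<exists>w\<in>cfg_lang P S. automaton_path (D (e x)) (f x) w (g x)))"
proof -
  note [computable] = computable_compose[OF \<open>computable b\<close>] computable_compose[OF \<open>computable e\<close>]
    computable_compose[OF \<open>computable f\<close>] computable_compose[OF \<open>computable g\<close>]
  define m where "m = Max (insert S (fst ` P))"
  have m: "X \<le> m" if "(X, \<beta>) \<in> P" for X \<beta> using P that by (force simp: m_def intro: Max_ge)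
  have "S \<le> m" using P by (simp add: m_def)
  have "recursive (\<lambda>z. \<forall>p\<in>P. \<forall>s<b (e (psnd z)). \<forall>t<b (e (psnd z)).
      chain (table (pfst z)) (D (e (psnd z))) (b (e (psnd z))) (snd p) s t \<longrightarrow> table (pfst z) (fst p) s t)"
    by (intro recursive_finite_ball[OF P] computable recursive_chain[OF D \<open>computable b\<close>])
  then have "recursive (\<lambda>z. closed_under P (table (pfst z)) (D (e (psnd z))) (b (e (psnd z))))"
    by (simp add: closed_under_def)
  then have "recursive (\<lambda>x. f x < b (e x) \<and> g x < b (e x) \<and>
      (\<forall>T<2 ^ Suc (pair m (pair (b (e x)) (b (e x)))).
        closed_under P (table T) (D (e x)) (b (e x)) \<longrightarrow> table T S (f x) (g x)))"
    by (intro computable)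
  moreover have "(\<exists>w\<in>cfg_lang P S. automaton_path (D (e x)) (f x) w (g x)) \<longleftrightarrow>
      (\<forall>T<2 ^ Suc (pair m (pair (b (e x)) (b (e x)))).
        closed_under P (table T) (D (e x)) (b (e x)) \<longrightarrow> table T S (f x) (g x))"
    if "f x < b (e x)" "g x < b (e x)" for x
    by (rule reachable_iff_tables[OF bound m \<open>S \<le> m\<close> that])
  ultimately show ?thesis by (simp cong: conj_cong del: power_Suc)
qed

section \<open>Coded instances and the decision procedure\<close>

lemma list_decode_le: "y \<in> set (list_decode n) \<Longrightarrow> y \<le> n"
proof (induction n rule: less_induct)
  case (less n)
  show ?case
  proof (cases n)
    case (Suc m)
    then have "y = pfst m \<or> y \<in> set (list_decode (psnd m))"
      using less.prems by (cases "prod_decode m") (simp add: pfst_def psnd_def)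
    then show ?thesis using less.IH[of "psnd m"] pfst_le[of m] psnd_le[of m] Suc by auto
  qed (use less.prems in simp)
qed

lemma list_encode_suffix_le: "list_encode y \<le> list_encode (z @ y)"
proof (induction z)
  case (Cons a z)
  then show ?case using le_prod_encode_2[of "list_encode (z @ y)" a] by simp
qed simp

abbreviation "initial_code x \<equiv> pfst (pfst x)"
abbreviation "transitions_code x \<equiv> pfst (psnd (pfst x))"
abbreviation "final_code x \<equiv> psnd (psnd (pfst x))"
abbreviation "word_code x \<equiv> psnd x"

text \<open>The automaton of an instance accepts the words \<open>u # w\<^sup>r\<close> with \<open>u\<close> accepted by the instance's
  automaton: the state \<open>2 p\<close> stands for its state \<open>p\<close>, and \<open>2 v + 1\<close> for having read, from the right,
  the suffix of \<open>w\<close> encoded by \<open>v\<close>.\<close>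
fun instance_step :: "('a \<Rightarrow> nat) \<Rightarrow> 'a set \<Rightarrow> nat \<Rightarrow> nat \<Rightarrow> 'a option \<Rightarrow> nat \<Rightarrow> bool" where
  "instance_step c A x s (Some a) t \<longleftrightarrow> t < 2 * x + 2 \<and> a \<in> A \<and>
     ((\<exists>p<Suc x. \<exists>q<Suc x. s = 2 * p \<and> t = 2 * q \<and>
        pair p (pair (c a) q) \<in> set (list_decode (transitions_code x))) \<or>
      (\<exists>v<Suc x. s = 2 * v + 1 \<and> t = 2 * Suc (pair (c a) v) + 1))"
| "instance_step c A x s None t \<longleftrightarrow> t = 1 \<and>
     (\<exists>p<Suc x. s = 2 * p \<and> p \<in> set (list_decode (final_code x)))"

lemma instance_step_less: "instance_step c A x s a t \<Longrightarrow> t < 2 * x + 2"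
  by (cases a) (auto simp: instance_step.simps)

lemma recursive_instance_step:
  "recursive (\<lambda>z. instance_step c A (pfst z) (pfst (psnd z)) a (psnd (psnd z)))"
  by (cases a; simp only: instance_step.simps; intro computable)

declare instance_step.simps [simp del]

context
  fixes c :: "'a \<Rightarrow> nat" and A :: "'a set" and \<A> :: "'a nfa" and w :: "'a list" and x :: nat
  assumes c: "inj_on c A" and over: "nfa_over A \<A>" and w: "w \<in> lists A"
    and x: "x = encode_instance c \<A> w"
begin

lemma codes:
  "initial_code x = list_encode (initial \<A>)"
  "transitions_code x = list_encode (map (\<lambda>(p, a, q). pair p (pair (c a) q)) (transitions \<A>))"
  "final_code x = list_encode (final \<A>)" "word_code x = list_encode (map c w)"
  by (simp_all add: x encode_instance_def encode_nfa_def)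

lemma codes_le: "initial_code x \<le> x" "transitions_code x \<le> x" "final_code x \<le> x" "word_code x \<le> x"
  by (meson order_trans pfst_le psnd_le)+

lemma transition_code_iff:
  assumes "a \<in> A"
  shows "pair p (pair (c a) q) \<in> set (list_decode (transitions_code x)) \<longleftrightarrow> (p, a, q) \<in> set (transitions \<A>)"
proof -
  have "(p, a', q) \<in> set (transitions \<A>) \<Longrightarrow> c a = c a' \<Longrightarrow> a' = a" for a'
    using c over assms by (auto simp: nfa_over_def dest: inj_onD)
  then show ?thesis by (force simp: codes)
qed

lemma instance_step_left:
  assumes "a \<in> A"
  shows "instance_step c A x (2 * p) (Some a) t \<longleftrightarrow> (\<exists>q. t = 2 * q \<and> (p, a, q) \<in> set (transitions \<A>))"
proof -
  have "p \<le> x \<and> q \<le> x \<and> 2 * q < 2 * x + 2" if "(p, a, q) \<in> set (transitions \<A>)" for q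
  proof -
    have "pair p (pair (c a) q) \<le> x"
      using list_decode_le[of "pair p (pair (c a) q)" "transitions_code x"] codes_le(2)
        transition_code_iff[OF assms] that by simp
    then show ?thesis
      using le_prod_encode_1[of p "pair (c a) q"] le_prod_encode_2[of "pair (c a) q" p]
        le_prod_encode_2[of q "c a"] by linarith
  qed
  \<comment> \<open>Parity keeps the two kinds of states apart.\<close>
  moreover have "2 * p \<noteq> 2 * v + 1" for v by presburger
  ultimately show ?thesis
    using assms by (auto simp: instance_step.simps transition_code_iff less_Suc_eq_le simp del: One_nat_def)
qed

lemma instance_path_left:
  "u \<in> lists A \<Longrightarrow> automaton_path (instance_step c A x) (2 * p) (map Some u) s \<longleftrightarrow>
    (\<exists>q. s = 2 * q \<and> nfa_path \<A> p u q)"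
proof (induction u arbitrary: p)
  case Nil
  have "nfa_path \<A> p [] q \<longleftrightarrow> q = p" for q by (auto intro: nfa_path.intros elim: nfa_path.cases)
  then show ?case by auto
next
  case (Cons a u)
  have "nfa_path \<A> p (a # u) q \<longleftrightarrow> (\<exists>r. (p, a, r) \<in> set (transitions \<A>) \<and> nfa_path \<A> r u q)" for q
    by (auto intro: nfa_path.intros elim: nfa_path.cases)
  then show ?case using Cons by (auto simp: automaton_path_Cons instance_step_left) blast
qed

text \<open>\<open>Suc (pair (c a) v)\<close> is the code of the list with head \<open>c a\<close>
  and tail coded by \<open>v\<close>: the automaton collects the letters that it reads.\<close>

lemma instance_step_right:
  assumes "a \<in> A"
  shows "instance_step c A x (2 * v + 1) (Some a) t \<longleftrightarrow> t = 2 * Suc (pair (c a) v) + 1 \<and> Suc (pair (c a) v) \<le> x"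
proof -
  have "2 * v + 1 \<noteq> 2 * p" for p by presburger
  moreover have "v \<le> pair (c a) v" by (rule le_prod_encode_2)
  ultimately show ?thesis using assms by (auto simp: instance_step.simps simp del: One_nat_def)
qed

text \<open>\<open>y\<close> is what has been collected before. Putting each letter in front undoes
  the reversal of the word after the separator.\<close>

lemma instance_path_right:
  "r \<in> lists A \<Longrightarrow> automaton_path (instance_step c A x) (2 * list_encode y + 1) (map Some r) (2 * word_code x + 1)
    \<longleftrightarrow> rev (map c r) @ y = map c w"
proof (induction r arbitrary: y)
  case Nil
  then show ?case by (auto simp: codes list_encode_eq)
next
  case (Cons a r)
  \<comment> \<open>The lists collected on the way to \<open>w\<close> are suffixes of its coded
    form, whose codes do not exceed that of \<open>w\<close>; so the bound on the states cuts off no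
    such path.\<close>
  have "Suc (pair (c a) (list_encode y)) \<le> x" if "rev (map c r) @ c a # y = map c w"
    using list_encode_suffix_le[of "c a # y" "rev (map c r)"] codes_le(4) that
    by (simp add: codes)
  then show ?case
    using Cons.IH[of "c a # y"] Cons.prems
    by (auto simp: automaton_path_Cons instance_step_right codes simp del: One_nat_def)
qed

lemma instance_path:
  assumes "u \<in> lists A" "v \<in> lists A"
  shows "automaton_path (instance_step c A x) (2 * p) (pair_word u v) (2 * word_code x + 1) \<longleftrightarrow>
    v = w \<and> (\<exists>q\<in>set (final \<A>). nfa_path \<A> p u q)"
proof -
  \<comment> \<open>The separator leads to the state 1, which is
    \<open>2 * list_encode [] + 1\<close>: nothing has been collected yet.\<close>
  have sep: "instance_step c A x (2 * q) None t \<longleftrightarrow> q \<in> set (final \<A>) \<and> t = 2 * list_encode [] + 1" for q t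
    using list_decode_le[of q "final_code x"] codes_le(3)
    by (auto simp: codes less_Suc_eq_le instance_step.simps)
  have right: "automaton_path (instance_step c A x) (2 * list_encode [] + 1) (map Some (rev v)) (2 * word_code x + 1)
      \<longleftrightarrow> v = w"
  proof -
    have "inj_on c (set v \<union> set w)" using assms(2) w by (intro inj_on_subset[OF c]) auto
    moreover have "rev v \<in> lists A" using assms(2) by auto
    ultimately show ?thesis
      using instance_path_right[of "rev v" "[]"] by (simp add: rev_map inj_on_map_eq_map)
  qed
  show ?thesis
    using assms(1) right
    by (auto simp: pair_word_def automaton_path_append automaton_path_Cons instance_path_left sep rev_map
        simp del: list_encode.simps One_nat_def)
qed

end

text \<open>Every number decodes to lists of numbers, so only the letters have to be checked to lie
  in the image of \<open>c\<close>. The bounds make the predicate recursive and exclude nothing, as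
  entries do not exceed the code of their list.\<close>

definition valid_instance :: "('a \<Rightarrow> nat) \<Rightarrow> 'a set \<Rightarrow> nat \<Rightarrow> bool" where
  "valid_instance c A x \<longleftrightarrow>
     (\<forall>y<Suc x. y \<in> set (list_decode (transitions_code x)) \<longrightarrow> pfst (psnd y) \<in> c ` A) \<and>
     (\<forall>y<Suc x. y \<in> set (list_decode (word_code x)) \<longrightarrow> y \<in> c ` A)"

lemma valid_instance_iff:
  "valid_instance c A x \<longleftrightarrow> (\<exists>\<A> w. x = encode_instance c \<A> w \<and> nfa_over A \<A> \<and> w \<in> lists A)"
proof
  assume valid: "valid_instance c A x"
  have less: "y < Suc x" if "y \<in> set (list_decode (transitions_code x)) \<or> y \<in> set (list_decode (word_code x))" for y
    using that list_decode_le[of y] pfst_le[of "psnd (pfst x)"] psnd_le[of "pfst x"] pfst_le[of x] psnd_le[of x]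
    by (meson less_Suc_eq_le order_trans)
  have tr: "pfst (psnd y) \<in> c ` A" if "y \<in> set (list_decode (transitions_code x))" for y
    using valid that less by (simp add: valid_instance_def)
  have wd: "y \<in> c ` A" if "y \<in> set (list_decode (word_code x))" for y
    using valid that less by (simp add: valid_instance_def)
  define ts where "ts = map (\<lambda>y. (pfst y, inv_into A c (pfst (psnd y)), psnd (psnd y))) (list_decode (transitions_code x))"
  define \<A> where "\<A> = NFA (list_decode (initial_code x)) ts (list_decode (final_code x))"
  define w where "w = map (inv_into A c) (list_decode (word_code x))"
  have "map (\<lambda>(p, a, q). pair p (pair (c a) q)) ts = list_decode (transitions_code x)"
    unfolding ts_def map_map by (rule map_idI) (use tr in \<open>simp add: f_inv_into_f\<close>)
  moreover have "map c w = list_decode (word_code x)"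
    unfolding w_def map_map by (rule map_idI) (use wd in \<open>simp add: f_inv_into_f\<close>)
  ultimately have "x = encode_instance c \<A> w"
    by (simp add: encode_instance_def encode_nfa_def \<A>_def)
  moreover have "nfa_over A \<A>" using tr by (auto simp: nfa_over_def \<A>_def ts_def inv_into_into)
  moreover have "w \<in> lists A" using wd by (auto simp: w_def inv_into_into)
  ultimately show "\<exists>\<A> w. x = encode_instance c \<A> w \<and> nfa_over A \<A> \<and> w \<in> lists A" by blast
next
  assume "\<exists>\<A> w. x = encode_instance c \<A> w \<and> nfa_over A \<A> \<and> w \<in> lists A"
  then show "valid_instance c A x"
    by (fastforce simp: valid_instance_def encode_instance_def encode_nfa_def nfa_over_def)
qed

lemma nfa_path_lists: "nfa_over A \<A> \<Longrightarrow> nfa_path \<A> p u q \<Longrightarrow> u \<in> lists A"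
  by (rotate_tac, induction rule: nfa_path.induct) (auto simp: nfa_over_def)

theorem rational_subset_membership_decidable_if_context_free:
  assumes A: "finite A" and cf: "context_free (word_problem A \<pi>)"
  shows "rational_subset_membership_decidable A \<pi>"
  unfolding rational_subset_membership_decidable_def
proof (intro allI impI)
  fix c :: "'a \<Rightarrow> nat" assume c: "inj_on c A"
  from cf obtain P :: "(nat, _) prods" and S where P: "finite P" "word_problem A \<pi> = cfg_lang P S"
    by (auto simp: context_free_def)
  \<comment> \<open>The inequalities between states bring \<open>?Q\<close> into the form of
    \<open>recursive_cfg_reachable\<close>.\<close>
  let ?Q = "\<lambda>x. valid_instance c A x \<and> (\<exists>p<Suc x. p \<in> set (list_decode (initial_code x)) \<and>
    2 * p < 2 * x + 2 \<and> 2 * word_code x + 1 < 2 * x + 2 \<and>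
    (\<exists>z\<in>cfg_lang P S. automaton_path (instance_step c A x) (2 * p) z (2 * word_code x + 1)))"
  have reachable: "recursive (\<lambda>z. 2 * pfst z < 2 * psnd z + 2 \<and> 2 * word_code (psnd z) + 1 < 2 * psnd z + 2 \<and>
    (\<exists>u\<in>cfg_lang P S. automaton_path (instance_step c A (psnd z)) (2 * pfst z) u (2 * word_code (psnd z) + 1)))"
    by (rule recursive_cfg_reachable[where b = "\<lambda>x. 2 * x + 2" and e = psnd and
          f = "\<lambda>z. 2 * pfst z" and g = "\<lambda>z. 2 * word_code (psnd z) + 1",
          OF P(1) recursive_instance_step])
      (erule instance_step_less, (intro computable)+)
  have "recursive (\<lambda>x. \<exists>p<Suc x. p \<in> set (list_decode (initial_code x)) \<and>
    2 * p < 2 * x + 2 \<and> 2 * word_code x + 1 < 2 * x + 2 \<and>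
    (\<exists>z\<in>cfg_lang P S. automaton_path (instance_step c A x) (2 * p) z (2 * word_code x + 1)))"
    by (rule recursive_bex[OF _ recursive_conj[OF _ reachable]]) (intro computable)+
  moreover have "recursive (valid_instance c A)"
    unfolding valid_instance_def using A by (intro computable recursive_finite_member finite_imageI)
  ultimately have "recursive ?Q" by (rule recursive_conj[rotated])
  then have "decidable {x. ?Q x}" by (rule recursive_imp_decidable)
  moreover have "{x. ?Q x} = {encode_instance c \<A> w | \<A> w.
      nfa_over A \<A> \<and> w \<in> lists A \<and> \<pi> w \<in> \<pi> ` nfa_lang \<A>}" (is "_ = ?I")
  proof -
    have "?Q x \<longleftrightarrow> \<pi> w \<in> \<pi> ` nfa_lang \<A>"
      if inst: "nfa_over A \<A>" "w \<in> lists A" "x = encode_instance c \<A> w" for x \<A> w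
    proof -
      note codes = codes[OF c inst] and le = codes_le[OF c inst] and path = instance_path[OF c inst]
      \<comment> \<open>The automaton forces the right-hand word to be \<open>w\<close>, so meeting
        the word problem means that some accepted \<open>u\<close> satisfies
        \<open>\<pi> u = \<pi> w\<close>.\<close>
      have *: "(\<exists>z\<in>cfg_lang P S. automaton_path (instance_step c A x) (2 * p) z (2 * word_code x + 1)) \<longleftrightarrow>
          (\<exists>u q. nfa_path \<A> p u q \<and> q \<in> set (final \<A>) \<and> \<pi> u = \<pi> w)" for p
      proof -
        have "(\<exists>z\<in>cfg_lang P S. automaton_path (instance_step c A x) (2 * p) z (2 * word_code x + 1)) \<longleftrightarrow>
          (\<exists>u v. u \<in> lists A \<and> v \<in> lists A \<and> \<pi> u = \<pi> v \<and>
            automaton_path (instance_step c A x) (2 * p) (pair_word u v) (2 * word_code x + 1))"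
          unfolding P(2)[symmetric] word_problem_def pair_word_def by blast
        also have "\<dots> \<longleftrightarrow> (\<exists>u. u \<in> lists A \<and> \<pi> u = \<pi> w \<and> (\<exists>q\<in>set (final \<A>). nfa_path \<A> p u q))"
          using path inst(2) by (metis (no_types, lifting))
        also have "\<dots> \<longleftrightarrow> (\<exists>u q. nfa_path \<A> p u q \<and> q \<in> set (final \<A>) \<and> \<pi> u = \<pi> w)"
          using nfa_path_lists[OF inst(1)] by blast
        finally show ?thesis .
      qed
      have p: "p < Suc x \<and> 2 * p < 2 * x + 2" if "p \<in> set (initial \<A>)" for p
      proof -
        have "p \<le> initial_code x" using list_decode_le[of p "initial_code x"] that by (simp add: codes(1))
        then show ?thesis using le(1) by linarith
      qed
      have decode: "list_decode (initial_code x) = initial \<A>" by (simp add: codes(1))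
      have word: "2 * word_code x + 1 < 2 * x + 2" using le(4) by linarith
      have "valid_instance c A x" unfolding valid_instance_iff using inst by (intro exI conjI)
      then have "?Q x \<longleftrightarrow> (\<exists>p<Suc x. p \<in> set (initial \<A>) \<and> 2 * p < 2 * x + 2 \<and>
          (\<exists>u q. nfa_path \<A> p u q \<and> q \<in> set (final \<A>) \<and> \<pi> u = \<pi> w))"
        unfolding * decode using word by blast
      also have "\<dots> \<longleftrightarrow> (\<exists>p\<in>set (initial \<A>). \<exists>u q. nfa_path \<A> p u q \<and> q \<in> set (final \<A>) \<and> \<pi> u = \<pi> w)"
        using p by meson
      also have "\<dots> \<longleftrightarrow> \<pi> w \<in> \<pi> ` nfa_lang \<A>"
      proof (intro iffI; elim imageE bexE exE conjE)
        fix p u q assume *: "p \<in> set (initial \<A>)" "nfa_path \<A> p u q" "q \<in> set (final \<A>)" "\<pi> u = \<pi> w"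
        then have "u \<in> nfa_lang \<A>" unfolding nfa_lang_def by blast
        then show "\<pi> w \<in> \<pi> ` nfa_lang \<A>" using *(4) by (intro image_eqI[of _ \<pi> u]) simp_all
      next
        fix u assume "\<pi> w = \<pi> u" "u \<in> nfa_lang \<A>"
        then show "\<exists>p\<in>set (initial \<A>). \<exists>u q. nfa_path \<A> p u q \<and> q \<in> set (final \<A>) \<and> \<pi> u = \<pi> w"
          by (auto simp: nfa_lang_def)
      qed
      finally show ?thesis .
    qed
    note Q = this
    show ?thesis
    proof (intro Set.set_eqI iffI)
      fix x assume "x \<in> {x. ?Q x}"
      then have x: "?Q x" by (rule CollectD)
      then have "valid_instance c A x" by (rule conjunct1)
      then obtain \<A> w where inst: "nfa_over A \<A>" "w \<in> lists A" "x = encode_instance c \<A> w"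
        unfolding valid_instance_iff by (elim exE conjE)
      from Q[OF inst] x have "\<pi> w \<in> \<pi> ` nfa_lang \<A>" by (rule iffD1)
      with inst show "x \<in> ?I" by (intro CollectI exI conjI)
    next
      fix x assume "x \<in> ?I"
      then obtain \<A> w where inst: "nfa_over A \<A>" "w \<in> lists A" "x = encode_instance c \<A> w"
        and "\<pi> w \<in> \<pi> ` nfa_lang \<A>" by (elim CollectE exE conjE)
      from Q[OF inst] this(4) have "?Q x" by (rule iffD2)
      then show "x \<in> {x. ?Q x}" unfolding mem_Collect_eq .
    qed
  qed
  ultimately show "decidable ?I" by (rule back_subst[of decidable])
qed

theorem corollary5p1:
  fixes A :: "'a set" and R :: "('a list \<times> 'a list) set" and \<alpha> :: "'a list"
    and B :: "'b set" and \<pi> :: "'b list \<Rightarrow> 'a list list set"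
  assumes "finite_presentation A R"
    and "weakly_compressible_wrt A R \<alpha>"
    and "finitely_generated_via (left_monoid A R \<alpha>) B \<pi>"
    and "context_free (word_problem B \<pi>)"
  shows "rational_subset_membership_decidable A (word_class A R)"
proof -
  interpret weak_compression A R \<alpha> using assms(1,2) by unfold_locales
  show ?thesis
    using finite_A context_free_word_problem[OF assms(3,4)]
    by (rule rational_subset_membership_decidable_if_context_free)
qed

end
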